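(* For every positive integer $N$, there exists an edge-capacitated undirected graph $G$ with a set $T$ of $6$ terminals such that every contraction-based flow sparsifier $H$ of $G$ with respect to $T$ with $|V(H)|\le N$ has quality at least $1+10^{-18}$; that is, there is a demand $\mathcal{D}$ on $T$ with $\mathrm{cong}_G(\mathcal{D})\ge (1+10^{-18})\cdot\mathrm{cong}_H(\mathcal{D})$.
   Context: Let $G=(V,E,c)$ be an undirected graph with positive edge capacities $c$, and $T\subseteq V$ a set of terminals. A demand $\mathcal{D}$ on $T$ assigns a real number $\mathcal{D}(t,t')\ge 0$ to each unordered pair $t,t'\in T$. A multicommodity flow routes $\mathcal{D}$ if it sends $\mathcal{D}(t,t')$ units of flow between $t$ and $t'$ for every pair. The congestion of a flow is the maximum over edges $e$ of (total flow through $e$)$/c(e)$, and $\mathrm{cong}_G(\mathcal{D})$ is the minimum congestion of a flow routing $\mathcal{D}$ in $G$. A graph $H$ with $T\subseteq V(H)$ is a flow sparsifier of $G$ w.r.t. $T$ of quality $q\ge 1$ if for every demand $\mathcal{D}$ on $T$, $\mathrm{cong}_H(\mathcal{D})\le \mathrm{cong}_G(\mathcal{D})\le q\cdot \mathrm{cong}_H(\mathcal{D})$. $H$ is a contraction-based flow sparsifier if there is a partition $\mathcal{F}$ of $V(G)$ in which distinct terminals lie in distinct parts, and $H$ is obtained from $G$ by contracting each part into a single vertex (keeping parallel edges with their capacities, discarding self-loops), the vertex obtained from the part containing terminal $t$ being identified with $t$. *)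

theory Defs
  imports Complex_Main "HOL-Library.Extended_Real" "HOL-Library.Disjoint_Sets"
begin

text \<open>Edges are abstract names, so parallel edges are possible; \<open>ends G e\<close> is the unordered
  pair of endpoints of \<open>e\<close>.\<close>

record ('v, 'e) cap_graph =
  verts :: "'v set"
  edges :: "'e set"
  ends  :: "'e \<Rightarrow> 'v set"
  cap   :: "'e \<Rightarrow> real"

definition cap_multigraph :: "('v, 'e) cap_graph \<Rightarrow> bool" where
  "cap_multigraph G \<longleftrightarrow> finite (verts G) \<and> finite (edges G) \<and>
     (\<forall>e\<in>edges G. ends G e \<subseteq> verts G \<and> card (ends G e) = 2 \<and> cap G e > 0)"

definition cap_simple_graph :: "('v, 'e) cap_graph \<Rightarrow> bool" where
  "cap_simple_graph G \<longleftrightarrow> cap_multigraph G \<and> inj_on (ends G) (edges G)"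

text \<open>A path lists its vertices and, because of parallel edges, also the edges joining
  consecutive ones.\<close>

type_synonym ('v, 'e) path = "'v list \<times> 'e list"

definition is_path :: "('v, 'e) cap_graph \<Rightarrow> ('v, 'e) path \<Rightarrow> bool" where
  "is_path G p \<longleftrightarrow> (case p of (vs, es) \<Rightarrow>
     length vs = Suc (length es) \<and> distinct vs \<and> set vs \<subseteq> verts G \<and> set es \<subseteq> edges G \<and>
     (\<forall>i<length es. ends G (es ! i) = {vs ! i, vs ! Suc i}))"

definition paths_between :: "('v, 'e) cap_graph \<Rightarrow> 'v set \<Rightarrow> ('v, 'e) path set" where
  "paths_between G P = {p. is_path G p \<and> {hd (fst p), last (fst p)} = P}"

definition terminal_pairs :: "'v set \<Rightarrow> 'v set set" where
  "terminal_pairs T = {P. P \<subseteq> T \<and> card P = 2}"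

definition terminal_paths :: "('v, 'e) cap_graph \<Rightarrow> 'v set \<Rightarrow> ('v, 'e) path set" where
  "terminal_paths G T = (\<Union>P\<in>terminal_pairs T. paths_between G P)"

text \<open>A demand is a function on unordered pairs: \<open>D {t, t'}\<close>. Its values away from
  \<open>terminal_pairs T\<close> are never used.\<close>

definition demand_on :: "'v set \<Rightarrow> ('v set \<Rightarrow> real) \<Rightarrow> bool" where
  "demand_on T D \<longleftrightarrow> (\<forall>P\<in>terminal_pairs T. D P \<ge> 0)"

text \<open>A path and its reversal both count towards the same unordered pair.\<close>

definition routes ::
  "('v, 'e) cap_graph \<Rightarrow> 'v set \<Rightarrow> ('v set \<Rightarrow> real) \<Rightarrow> (('v, 'e) path \<Rightarrow> real) \<Rightarrow> bool" where
  "routes G T D f \<longleftrightarrow> (\<forall>p\<in>terminal_paths G T. f p \<ge> 0) \<and>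
     (\<forall>P\<in>terminal_pairs T. (\<Sum>p\<in>paths_between G P. f p) = D P)"

definition edge_flow ::
  "('v, 'e) cap_graph \<Rightarrow> 'v set \<Rightarrow> (('v, 'e) path \<Rightarrow> real) \<Rightarrow> 'e \<Rightarrow> real" where
  "edge_flow G T f e = (\<Sum>p\<in>{p \<in> terminal_paths G T. e \<in> set (snd p)}. f p)"

text \<open>The inserted \<open>0\<close> only matters for graphs without edges.\<close>

definition flow_congestion ::
  "('v, 'e) cap_graph \<Rightarrow> 'v set \<Rightarrow> (('v, 'e) path \<Rightarrow> real) \<Rightarrow> real" where
  "flow_congestion G T f = Max (insert 0 ((\<lambda>e. edge_flow G T f e / cap G e) ` edges G))"

text \<open>The congestion is \<open>\<infinity>\<close> exactly when no flow routes the demand.\<close>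

definition congestion :: "('v, 'e) cap_graph \<Rightarrow> 'v set \<Rightarrow> ('v set \<Rightarrow> real) \<Rightarrow> ereal" where
  "congestion G T D = (INF f\<in>{f. routes G T D f}. ereal (flow_congestion G T f))"

definition flow_sparsifier ::
  "('v, 'e) cap_graph \<Rightarrow> 'v set \<Rightarrow> real \<Rightarrow> ('v, 'f) cap_graph \<Rightarrow> bool" where
  "flow_sparsifier G T q H \<longleftrightarrow> q \<ge> 1 \<and> T \<subseteq> verts H \<and>
     (\<forall>D. demand_on T D \<longrightarrow> congestion H T D \<le> congestion G T D \<and> congestion G T D \<le> ereal q * congestion H T D)"

text \<open>The vertex obtained by contracting a part is named by a member of that part, namely by
  its terminal if it has one. So the contracted graph has the same vertex type and contains the
  terminals themselves.\<close>

definition part_vertex :: "'v set \<Rightarrow> 'v set \<Rightarrow> 'v" where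
  "part_vertex T P = (SOME v. v \<in> P \<and> (P \<inter> T \<noteq> {} \<longrightarrow> v \<in> T))"

definition part_of :: "'v set set \<Rightarrow> 'v \<Rightarrow> 'v set" where
  "part_of F v = (THE P. P \<in> F \<and> v \<in> P)"

definition contract ::
  "('v, 'e) cap_graph \<Rightarrow> 'v set \<Rightarrow> 'v set set \<Rightarrow> ('v, 'e) cap_graph" where
  "contract G T F =
     \<lparr> verts = part_vertex T ` F,
       edges = {e \<in> edges G. \<not> (\<exists>P\<in>F. ends G e \<subseteq> P)},
       ends  = (\<lambda>e. (\<lambda>v. part_vertex T (part_of F v)) ` ends G e),
       cap   = cap G \<rparr>"

definition contraction_based ::
  "('v, 'e) cap_graph \<Rightarrow> 'v set \<Rightarrow> ('v, 'e) cap_graph \<Rightarrow> bool" where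
  "contraction_based G T H \<longleftrightarrow>
     (\<exists>F. partition_on (verts G) F \<and>
          (\<forall>P\<in>F. \<forall>t\<in>P \<inter> T. \<forall>t'\<in>P \<inter> T. t = t') \<and>
          H = contract G T F)"

end

theory Submission
  imports Defs "HOL-Analysis.Function_Topology" "HOL-Library.Nat_Bijection"
begin

text \<open>By linear programming duality, a graph loses a factor \<open>1 + \<epsilon>\<close> under a contraction iff for some
  terminal distances \<open>d\<close> every metric on the contracted graph that dominates \<open>d\<close> has volume at least
  \<open>1 + \<epsilon>\<close> times the least volume of such a metric on the original graph. The graph is a fine lattice
  in three-dimensional \<open>\<ell>\<^sub>\<infinity>\<close>-space with edges along the four body diagonals of the cube, and
  terminals \<open>s\<^sub>c\<close>, \<open>t\<^sub>c\<close> far out on the coordinate axes, joined to the ends of the lattice lines, so that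
  every line is a geodesic of each of the three pairs \<open>s\<^sub>c\<close>, \<open>t\<^sub>c\<close>. Additional geodesics from \<open>s\<^sub>1\<close> to
  \<open>s\<^sub>2\<close> and from \<open>t\<^sub>1\<close> to \<open>t\<^sub>2\<close> through two opposite faces keep the lattice from collapsing to a point.

  A metric of nearly optimal volume on a contracted graph gives three distance functions \<open>\<phi>\<^sub>c\<close> on the
  lattice points, with at most \<open>N\<close> values each, such that along almost every edge all three change by
  the same absolute amount and with the right signs. Four body diagonals are so rigid that this makes
  the second differences of \<open>\<phi>\<^sub>1\<close> along one direction small on average, at every scale. But a
  function with \<open>N\<close> values along a line is a staircase, and by pigeonhole over dyadic scales there is a
  scale at which its jumps are isolated, so that its second differences are as large as its first ones.\<close>

section \<open>Duality\<close>

text \<open>The box is compact by Tychonoff even if the index type is infinite, so flows may be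
  total functions. In the application \<open>b\<close> vanishes off a finite set.\<close>

lemma nonneg_box_attains_inf:
  fixes \<Phi> :: "('i \<Rightarrow> real) \<Rightarrow> real" and b d :: "'i \<Rightarrow> real"
  assumes "continuous_on UNIV \<Phi>" "X \<noteq> {}"
    and X: "X = {f. (\<forall>p. 0 \<le> f p \<and> f p \<le> b p) \<and> (\<Sum>p\<in>J. d p * f p) = K}"
  shows "\<exists>f\<in>X. \<forall>g\<in>X. \<Phi> f \<le> \<Phi> g"
proof -
  have "compactin (product_topology (\<lambda>i::'i. euclidean) UNIV) (PiE UNIV (\<lambda>p. {0..b p}))"
    by (subst compactin_PiE) auto
  then have "compact (PiE UNIV (\<lambda>p. {0..b p}))"
    by (simp add: euclidean_product_topology)
  moreover have "closed {f. (\<Sum>p\<in>J. d p * f p) = K}"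
    by (intro closed_Collect_eq continuous_intros)
      (auto intro!: continuous_on_product_then_coordinatewise continuous_on_id)
  moreover have "X = PiE UNIV (\<lambda>p. {0..b p}) \<inter> {f. (\<Sum>p\<in>J. d p * f p) = K}"
    unfolding X by (auto simp: PiE_def Pi_def)
  ultimately have "compact X"
    by (simp add: compact_Int_closed)
  then show ?thesis
    using continuous_attains_inf[of X \<Phi>] assms(1,2) continuous_on_subset by blast
qed

text \<open>Minimise the sum of squared overflows over all flows of value \<open>K\<close>. If the minimum is positive,
  then the overflows at a minimiser are, up to scaling, the dual lengths.\<close>

lemma packing_alternative:
  fixes a :: "'i \<Rightarrow> 'e \<Rightarrow> real" and d :: "'i \<Rightarrow> real" and c :: "'e \<Rightarrow> real"
  assumes fin: "finite I" "finite E"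
    and a: "\<And>p e. p \<in> I \<Longrightarrow> e \<in> E \<Longrightarrow> 0 \<le> a p e"
    and d: "\<And>p. p \<in> I \<Longrightarrow> 0 \<le> d p"
    and c: "\<And>e. e \<in> E \<Longrightarrow> 0 \<le> c e"
    and K: "0 < K"
  obtains (flow) f where "\<And>p. 0 \<le> f p" "\<And>e. e \<in> E \<Longrightarrow> (\<Sum>p\<in>I. a p e * f p) \<le> c e"
      "(\<Sum>p\<in>I. d p * f p) = K"
  | (dual) l where "\<And>e. 0 \<le> l e" "\<And>p. p \<in> I \<Longrightarrow> d p \<le> (\<Sum>e\<in>E. a p e * l e)"
      "(\<Sum>e\<in>E. c e * l e) < K"
proof -
  define J where "J = {p\<in>I. d p > 0}"
  have J: "finite J" "J \<subseteq> I" using fin by (auto simp: J_def)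
  \<comment> \<open>A nonnegative \<open>f\<close> of value \<open>K\<close> on \<open>J\<close> has
    \<open>d p * f p \<le> K\<close> there, so the bound excludes nothing and only makes the
    feasible set compact. Indices of value zero get no flow.\<close>
  define b where "b p = (if p \<in> J then K / d p else 0)" for p
  define X where "X = {f. (\<forall>p. 0 \<le> f p \<and> f p \<le> b p) \<and> (\<Sum>p\<in>J. d p * f p) = K}"
  define pt where "pt q = (\<lambda>p. if p = q then K / d q else 0)" for q
  have ptX: "pt q \<in> X" if "q \<in> J" for q
  proof -
    have "(\<Sum>p\<in>J. d p * pt q p) = (\<Sum>p\<in>J. if p = q then K else 0)"
      using that by (intro sum.cong) (auto simp: pt_def J_def)
    also have "\<dots> = K" using that J by simp
    finally show ?thesis using that K by (auto simp: X_def pt_def b_def J_def)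
  qed
  define F where "F f e = (\<Sum>p\<in>J. a p e * f p)" for f e
  define \<Phi> where "\<Phi> f = (\<Sum>e\<in>E. (max 0 (F f e - c e))\<^sup>2)" for f
  have Fconv: "F (\<lambda>p. f p + t * (g p - f p)) e = F f e + t * (F g e - F f e)" for f g t e
    unfolding F_def
    by (simp add: algebra_simps sum.distrib sum_subtractf sum_distrib_left)
  show thesis
  proof (cases "J = {}")
    case True
    then show thesis using dual[of "\<lambda>_. 0"] K d by (force simp: J_def)
  next
    case False
    then have ne: "X \<noteq> {}" using ptX by auto
    have cont: "continuous_on UNIV \<Phi>"
      unfolding \<Phi>_def F_def
      by (intro continuous_intros)
        (auto intro!: continuous_on_product_then_coordinatewise continuous_on_id)
    obtain f where f: "f \<in> X" "\<And>g. g \<in> X \<Longrightarrow> \<Phi> f \<le> \<Phi> g"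
      using nonneg_box_attains_inf[OF cont ne X_def] by auto
    define l where "l e = max 0 (F f e - c e)" for e
    have fJ: "f p = 0" if "p \<notin> J" for p
      using f(1) that unfolding X_def b_def by (auto intro: order_antisym dest: spec[of _ p])
    have sumJ: "(\<Sum>p\<in>I. x p * f p) = (\<Sum>p\<in>J. x p * f p)" for x
      using J fin fJ by (intro sum.mono_neutral_right) auto
    show thesis
    proof (cases "\<forall>e\<in>E. l e = 0")
      case True
      show thesis
      proof (rule flow[of f])
        show "0 \<le> f p" for p using f(1) by (auto simp: X_def)
        show "(\<Sum>p\<in>I. a p e * f p) \<le> c e" if "e \<in> E" for e
          using True that unfolding l_def F_def sumJ by (metis diff_le_0_iff_le max.cobounded2)
        show "(\<Sum>p\<in>I. d p * f p) = K" using f(1) by (auto simp: X_def sumJ)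
      qed
    next
      case False
      \<comment> \<open>The scaling for which optimality, tested against the points
        \<open>pt p\<close>, reads
        \<open>\<mu> * d p \<le> (\<Sum>e\<in>E. a p e * l e)\<close>.\<close>
      define \<mu> where "\<mu> = (\<Sum>e\<in>E. l e * F f e) / K"
      \<comment> \<open>First-order optimality: a step of length \<open>t\<close> towards
        \<open>g\<close> changes \<open>\<Phi>\<close> by at most
        \<open>t * (2 * A + t * B)\<close>. If \<open>A\<close> were negative, the chosen
        \<open>t\<close> would make this negative.\<close>
      have opt: "0 \<le> (\<Sum>e\<in>E. l e * (F g e - F f e))" if "g \<in> X" for g
      proof (rule ccontr)
        define A where "A = (\<Sum>e\<in>E. l e * (F g e - F f e))"
        define B where "B = (\<Sum>e\<in>E. (F g e - F f e)\<^sup>2)"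
        assume "\<not> ?thesis"
        then have A: "A < 0" by (simp add: A_def)
        have B: "0 \<le> B" by (auto simp: B_def intro: sum_nonneg)
        define t where "t = min 1 (- A / (B + 1))"
        have t: "0 < t" "t \<le> 1" using A B by (auto simp: t_def divide_neg_pos)
        define g' where "g' = (\<lambda>p. f p + t * (g p - f p))"
        have "g' \<in> X"
        proof -
          have eq: "g' p = (1 - t) * f p + t * g p" for p by (simp add: g'_def algebra_simps)
          have "0 \<le> g' p" for p
            using t f(1) that by (auto simp: eq X_def)
          moreover have "g' p \<le> b p" for p
          proof -
            have "g' p \<le> (1 - t) * b p + t * b p"
              unfolding eq using t f(1) that by (intro add_mono mult_left_mono) (auto simp: X_def)
            then show ?thesis by (simp add: algebra_simps)
          qed
          moreover have "(\<Sum>p\<in>J. d p * g' p) = (1 - t) * (\<Sum>p\<in>J. d p * f p) + t * (\<Sum>p\<in>J. d p * g p)"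
            unfolding eq by (simp add: algebra_simps sum.distrib sum_subtractf sum_distrib_left)
          then have "(\<Sum>p\<in>J. d p * g' p) = K"
            using f(1) that by (simp add: X_def algebra_simps)
          ultimately show ?thesis by (simp add: X_def)
        qed
        have "\<Phi> g' \<le> (\<Sum>e\<in>E. (l e + t * (F g e - F f e))\<^sup>2)"
          unfolding \<Phi>_def
        proof (rule sum_mono)
          fix e
          have "F g' e - c e \<le> l e + t * (F g e - F f e)"
            unfolding g'_def Fconv by (simp add: l_def)
          then have "max 0 (F g' e - c e) \<le> \<bar>l e + t * (F g e - F f e)\<bar>" by linarith
          then show "(max 0 (F g' e - c e))\<^sup>2 \<le> (l e + t * (F g e - F f e))\<^sup>2"
            by (metis abs_le_square_iff abs_of_nonneg max.cobounded1)
        qed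
        also have "\<dots> = \<Phi> f + 2 * t * A + t\<^sup>2 * B"
          unfolding \<Phi>_def A_def B_def l_def[symmetric] sum_distrib_left sum.distrib[symmetric]
          by (intro sum.cong refl) (simp add: power2_eq_square algebra_simps)
        finally have "\<Phi> g' \<le> \<Phi> f + t * (2 * A + t * B)" by (simp add: algebra_simps power2_eq_square)
        moreover have "2 * A + t * B < 0"
        proof -
          have "t * B \<le> (- A / (B + 1)) * B" using B by (intro mult_right_mono) (auto simp: t_def)
          also have "\<dots> \<le> - A" using A B by (simp add: field_simps)
          finally show ?thesis using A by linarith
        qed
        ultimately have "\<Phi> g' < \<Phi> f" using t(1) by (smt (verit) mult_pos_neg)
        then show False using f(2)[OF \<open>g' \<in> X\<close>] by simp
      qed
      \<comment> \<open>Where \<open>l e\<close> is nonzero it equals \<open>F f e - c e\<close>.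
        Hence the volume of \<open>l\<close> falls short of \<open>K * \<mu>\<close> by the sum of
        its squares, which is positive.\<close>
      have lc: "l e * c e = l e * F f e - (l e)\<^sup>2" for e
        by (auto simp: l_def max_def power2_eq_square algebra_simps)
      obtain e0 where e0: "e0 \<in> E" "l e0 \<noteq> 0" using False by auto
      have "0 < (\<Sum>e\<in>E. (l e)\<^sup>2)"
        using fin e0 by (intro sum_pos2[of _ e0]) auto
      then have lt: "(\<Sum>e\<in>E. c e * l e) < K * \<mu>"
        using K by (simp add: \<mu>_def mult.commute[of "c _"] lc sum_subtractf)
      have "0 \<le> (\<Sum>e\<in>E. c e * l e)" using c by (intro sum_nonneg) (auto simp: l_def)
      with lt K have \<mu>: "0 < \<mu>" by (metis le_less_trans zero_less_mult_pos)
      show thesis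
      proof (rule dual[of "\<lambda>e. l e / \<mu>"])
        show "0 \<le> l e / \<mu>" for e using \<mu> by (simp add: l_def)
        show "(\<Sum>e\<in>E. c e * (l e / \<mu>)) < K"
          using lt \<mu> by (simp add: sum_divide_distrib[symmetric] field_simps)
        show "d p \<le> (\<Sum>e\<in>E. a p e * (l e / \<mu>))" if p: "p \<in> I" for p
        proof (cases "p \<in> J")
          case True
          have "F (pt p) e = K / d p * a p e" for e
          proof -
            have "F (pt p) e = (\<Sum>q\<in>J. if q = p then K / d p * a p e else 0)"
              unfolding F_def by (intro sum.cong) (auto simp: pt_def)
            then show ?thesis using True J by simp
          qed
          moreover have "K * \<mu> = (\<Sum>e\<in>E. l e * F f e)" using K by (simp add: \<mu>_def)
          ultimately have "K * \<mu> \<le> K / d p * (\<Sum>e\<in>E. a p e * l e)"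
            using opt[OF ptX[OF True]]
            by (simp add: sum_distrib_left right_diff_distrib sum_subtractf mult_ac)
          then show ?thesis
            using \<mu> K True by (simp add: sum_divide_distrib[symmetric] field_simps J_def)
        next
          case False
          then have "d p = 0" using p d[OF p] by (auto simp: J_def)
          then show ?thesis using a[OF p] \<mu> by (auto intro!: sum_nonneg simp: l_def)
        qed
      qed
    qed
  qed
qed

section \<open>Paths, edge flows and weak duality\<close>

lemma finite_is_path:
  assumes "finite (verts G)" "finite (edges G)"
  shows "finite {p. is_path G p}"
proof (rule finite_subset)
  let ?n = "card (verts G)"
  show "{p. is_path G p} \<subseteq> {vs. set vs \<subseteq> verts G \<and> length vs \<le> ?n} \<times> {es. set es \<subseteq> edges G \<and> length es \<le> ?n}"
  proof
    fix p assume "p \<in> {p. is_path G p}"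
    moreover obtain vs es where [simp]: "p = (vs, es)" by (cases p)
    ultimately have p: "is_path G (vs, es)" by simp
    then have "length vs = card (set vs)" by (simp add: is_path_def distinct_card)
    also have "\<dots> \<le> ?n" using p assms by (intro card_mono) (auto simp: is_path_def)
    finally show "p \<in> {vs. set vs \<subseteq> verts G \<and> length vs \<le> ?n} \<times> {es. set es \<subseteq> edges G \<and> length es \<le> ?n}"
      using p by (auto simp: is_path_def)
  qed
  show "finite ({vs. set vs \<subseteq> verts G \<and> length vs \<le> ?n} \<times> {es. set es \<subseteq> edges G \<and> length es \<le> ?n})"
    using assms by (intro finite_cartesian_product finite_lists_length_le)
qed

lemma path_edges_subset: "is_path G p \<Longrightarrow> set (snd p) \<subseteq> edges G"
  by (cases p) (simp add: is_path_def)

lemma paths_between_subset: "paths_between G P \<subseteq> {p. is_path G p}"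
  by (auto simp: paths_between_def)

lemma terminal_paths_subset: "terminal_paths G T \<subseteq> {p. is_path G p}"
  by (auto simp: terminal_paths_def paths_between_def)

lemma finite_terminal_pairs: "finite T \<Longrightarrow> finite (terminal_pairs T)"
  by (rule finite_subset[of _ "Pow T"]) (auto simp: terminal_pairs_def)

lemma sum_terminal_paths:
  fixes g :: "('v, 'e) path \<Rightarrow> real"
  assumes "finite (verts G)" "finite (edges G)" "finite T"
  shows "(\<Sum>p\<in>terminal_paths G T. g p) = (\<Sum>P\<in>terminal_pairs T. \<Sum>p\<in>paths_between G P. g p)"
  unfolding terminal_paths_def
proof (rule sum.UNION_disjoint)
  show "finite (terminal_pairs T)" by (rule finite_terminal_pairs[OF assms(3)])
  show "\<forall>P\<in>terminal_pairs T. finite (paths_between G P)"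
    using finite_subset[OF paths_between_subset finite_is_path[OF assms(1,2)]] by blast
  show "\<forall>P\<in>terminal_pairs T. \<forall>Q\<in>terminal_pairs T. P \<noteq> Q \<longrightarrow> paths_between G P \<inter> paths_between G Q = {}"
    by (auto simp: paths_between_def)
qed

text \<open>A repeated edge would repeat a pair of consecutive vertices. Distinctness lets the
  length of a path be a sum over \<open>set es\<close>.\<close>

lemma path_edges_distinct:
  assumes "is_path G (vs, es)"
  shows "distinct es"
  unfolding distinct_conv_nth
proof (intro allI impI notI)
  fix i j assume ij: "i < length es" "j < length es" "i \<noteq> j" "es ! i = es ! j"
  have "ends G (es ! i) = {vs ! i, vs ! Suc i}" "ends G (es ! j) = {vs ! j, vs ! Suc j}"
    using assms ij(1,2) unfolding is_path_def by blast+
  then have "{vs ! i, vs ! Suc i} = {vs ! j, vs ! Suc j}" using ij by simp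
  moreover have "vs ! a = vs ! b \<longleftrightarrow> a = b" if "a < length vs" "b < length vs" for a b
    using assms that by (simp add: is_path_def nth_eq_iff_index_eq)
  moreover have "length vs = Suc (length es)" using assms by (simp add: is_path_def)
  ultimately show False using ij by (auto simp: doubleton_eq_iff)
qed

text \<open>Telescoping along the path: a potential that is 1-Lipschitz for \<open>l\<close>
  certifies a lower bound on path lengths.\<close>

lemma potential_le_path_length:
  fixes \<Phi> :: "'v \<Rightarrow> real"
  assumes p: "is_path G (vs, es)"
    and lip: "\<And>e x y. e \<in> edges G \<Longrightarrow> ends G e = {x, y} \<Longrightarrow> \<bar>\<Phi> y - \<Phi> x\<bar> \<le> l e"
  shows "\<bar>\<Phi> (last vs) - \<Phi> (hd vs)\<bar> \<le> (\<Sum>e\<in>set es. l e)"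
proof -
  let ?n = "length es"
  have len: "length vs = Suc ?n" using p by (simp add: is_path_def)
  then have "\<Phi> (last vs) - \<Phi> (hd vs) = \<Phi> (vs ! ?n) - \<Phi> (vs ! 0)"
    by (metis Zero_not_Suc diff_Suc_1 hd_conv_nth last_conv_nth list.size(3))
  also have "\<dots> = (\<Sum>i<?n. \<Phi> (vs ! Suc i) - \<Phi> (vs ! i))"
    by (rule sum_lessThan_telescope[symmetric])
  also have "\<bar>\<dots>\<bar> \<le> (\<Sum>i<?n. \<bar>\<Phi> (vs ! Suc i) - \<Phi> (vs ! i)\<bar>)" by (rule sum_abs)
  also have "\<dots> \<le> (\<Sum>i<?n. l (es ! i))"
    using p by (intro sum_mono lip) (auto simp: is_path_def)
  also have "\<dots> = sum_list (map l es)" by (simp add: sum_list_sum_nth atLeast0LessThan)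
  also have "\<dots> = (\<Sum>e\<in>set es. l e)"
    by (rule sum_list_distinct_conv_sum_set[OF path_edges_distinct[OF p]])
  finally show ?thesis .
qed

lemma sum_edge_flow:
  assumes fin: "finite (verts G)" "finite (edges G)"
  shows "(\<Sum>e\<in>edges G. l e * edge_flow G T f e) =
    (\<Sum>p\<in>terminal_paths G T. f p * (\<Sum>e\<in>set (snd p). l e))"
proof -
  let ?T = "terminal_paths G T"
  have finT: "finite ?T" by (rule finite_subset[OF terminal_paths_subset finite_is_path[OF fin]])
  have "(\<Sum>e\<in>edges G. l e * edge_flow G T f e) =
      (\<Sum>e\<in>edges G. \<Sum>p\<in>?T. if e \<in> set (snd p) then l e * f p else 0)"
    unfolding edge_flow_def sum_distrib_left
    using finT by (intro sum.cong[OF refl]) (simp add: sum.inter_filter)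
  also have "\<dots> = (\<Sum>p\<in>?T. \<Sum>e\<in>edges G. if e \<in> set (snd p) then l e * f p else 0)"
    by (rule sum.swap)
  also have "\<dots> = (\<Sum>p\<in>?T. f p * (\<Sum>e\<in>set (snd p). l e))"
  proof (rule sum.cong[OF refl])
    fix p assume "p \<in> ?T"
    then have "set (snd p) \<subseteq> edges G"
      using terminal_paths_subset[of G T] path_edges_subset by blast
    then have "{e \<in> edges G. e \<in> set (snd p)} = set (snd p)" by auto
    then show "(\<Sum>e\<in>edges G. if e \<in> set (snd p) then l e * f p else 0) = f p * (\<Sum>e\<in>set (snd p). l e)"
      using fin by (simp add: sum.inter_filter[symmetric] sum_distrib_left mult.commute)
  qed
  finally show ?thesis .
qed

text \<open>Weak duality: the total length travelled by a flow is at least the demand weighted by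
  \<open>d\<close>, and at most its congestion times the volume of \<open>l\<close>.\<close>

lemma congestion_ge_dual:
  assumes fin: "finite (verts G)" "finite (edges G)" "finite T"
    and cap: "\<And>e. e \<in> edges G \<Longrightarrow> 0 < cap G e"
    and l: "\<And>e. e \<in> edges G \<Longrightarrow> 0 \<le> l e"
    and dist: "\<And>P p. P \<in> terminal_pairs T \<Longrightarrow> p \<in> paths_between G P \<Longrightarrow> d P \<le> (\<Sum>e\<in>set (snd p). l e)"
    and W: "0 < (\<Sum>e\<in>edges G. cap G e * l e)"
    and x: "x * (\<Sum>e\<in>edges G. cap G e * l e) \<le> (\<Sum>P\<in>terminal_pairs T. d P * D P)"
  shows "ereal x \<le> congestion G T D"
  unfolding congestion_def
proof (rule INF_greatest, clarify)
  let ?W = "\<Sum>e\<in>edges G. cap G e * l e"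
  fix f assume f: "routes G T D f"
  have f0: "0 \<le> f p" if "P \<in> terminal_pairs T" "p \<in> paths_between G P" for p P
    using f that by (auto simp: routes_def terminal_paths_def)
  have "x * ?W \<le> (\<Sum>P\<in>terminal_pairs T. \<Sum>p\<in>paths_between G P. f p * d P)"
  proof -
    have "(\<Sum>p\<in>paths_between G P. f p * d P) = d P * D P" if "P \<in> terminal_pairs T" for P
      using f that by (simp add: routes_def flip: sum_distrib_right)
    then show ?thesis using x by simp
  qed
  also have "\<dots> \<le> (\<Sum>P\<in>terminal_pairs T. \<Sum>p\<in>paths_between G P. f p * (\<Sum>e\<in>set (snd p). l e))"
    using f0 dist by (intro sum_mono mult_left_mono) auto
  also have "\<dots> = (\<Sum>e\<in>edges G. l e * edge_flow G T f e)"
    by (simp add: sum_edge_flow fin sum_terminal_paths)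
  also have "\<dots> \<le> (\<Sum>e\<in>edges G. flow_congestion G T f * (cap G e * l e))"
  proof (rule sum_mono)
    fix e assume e: "e \<in> edges G"
    then have "edge_flow G T f e / cap G e \<le> flow_congestion G T f"
      unfolding flow_congestion_def using fin by (intro Max_ge) auto
    then have "edge_flow G T f e \<le> flow_congestion G T f * cap G e"
      using cap[OF e] by (simp add: field_simps)
    from mult_left_mono[OF this l[OF e]]
    show "l e * edge_flow G T f e \<le> flow_congestion G T f * (cap G e * l e)"
      by (simp add: mult_ac)
  qed
  also have "\<dots> = flow_congestion G T f * ?W" by (rule sum_distrib_left[symmetric])
  finally show "ereal x \<le> ereal (flow_congestion G T f)" using W by simp
qed

text \<open>By \<open>gap\<close>, the dual alternative of \<open>packing_alternative\<close> is
  impossible for \<open>H\<close>, so a flow of value \<open>x * W\<close> respects the capacities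
  of \<open>H\<close>. The demand it routes has congestion at most 1 in \<open>H\<close>, while weak
  duality with \<open>l\<close> forces at least \<open>x\<close> in \<open>G\<close>.\<close>

lemma demand_gap_if_dual_gap:
  fixes G :: "('v, 'e) cap_graph" and H :: "('v, 'f) cap_graph"
  assumes G: "finite (verts G)" "finite (edges G)" and T: "finite T"
    and capG: "\<And>e. e \<in> edges G \<Longrightarrow> 0 < cap G e"
    and l: "\<And>e. e \<in> edges G \<Longrightarrow> 0 \<le> l e"
    and dist: "\<And>P p. P \<in> terminal_pairs T \<Longrightarrow> p \<in> paths_between G P \<Longrightarrow> d P \<le> (\<Sum>e\<in>set (snd p). l e)"
    and W: "W = (\<Sum>e\<in>edges G. cap G e * l e)" "0 < W"
    and H: "finite (verts H)" "finite (edges H)"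
    and capH: "\<And>e. e \<in> edges H \<Longrightarrow> 0 < cap H e"
    and d: "\<And>P. 0 \<le> d P"
    and x: "0 < x"
    and gap: "\<And>l. (\<And>e. 0 \<le> l e) \<Longrightarrow>
      (\<And>P p. P \<in> terminal_pairs T \<Longrightarrow> p \<in> paths_between H P \<Longrightarrow> d P \<le> (\<Sum>e\<in>set (snd p). l e)) \<Longrightarrow>
      x * W \<le> (\<Sum>e\<in>edges H. cap H e * l e)"
  shows "\<exists>D. demand_on T D \<and> 0 < congestion H T D \<and> congestion H T D < \<infinity> \<and>
    congestion G T D \<ge> ereal x * congestion H T D"
proof -
  let ?I = "terminal_paths H T"
  define a :: "('v, 'f) path \<Rightarrow> 'f \<Rightarrow> real" where "a p e = (if e \<in> set (snd p) then 1 else 0)" for p e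
  define \<delta> where "\<delta> p = d {hd (fst p), last (fst p)}" for p :: "('v, 'f) path"
  have finI: "finite ?I" by (rule finite_subset[OF terminal_paths_subset finite_is_path[OF H]])
  have sub: "set (snd p) \<subseteq> edges H" if "p \<in> ?I" for p
    using that terminal_paths_subset[of H T] path_edges_subset by blast
  have K: "0 < x * W" using x W by simp
  show ?thesis
  proof (rule packing_alternative[OF finI H(2), of a \<delta> "cap H" "x * W"])
    fix l assume 8: "\<And>e. 0 \<le> l e" "\<And>p. p \<in> ?I \<Longrightarrow> \<delta> p \<le> (\<Sum>e\<in>edges H. a p e * l e)"
      "(\<Sum>e\<in>edges H. cap H e * l e) < x * W"
    have "d P \<le> (\<Sum>e\<in>set (snd p). l e)" if "P \<in> terminal_pairs T" "p \<in> paths_between H P" for P p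
    proof -
      have p: "p \<in> ?I" "\<delta> p = d P"
        using that by (auto simp: terminal_paths_def \<delta>_def paths_between_def)
      have "(\<Sum>e\<in>edges H. a p e * l e) = (\<Sum>e\<in>{e \<in> edges H. e \<in> set (snd p)}. l e)"
        using H by (subst sum.inter_filter) (auto simp: a_def intro!: sum.cong)
      also have "{e \<in> edges H. e \<in> set (snd p)} = set (snd p)" using sub[OF p(1)] by auto
      finally show ?thesis using 8(2)[OF p(1)] p(2) by simp
    qed
    from gap[OF 8(1) this] 8(3) show ?thesis by simp
  next
    fix f assume 7: "\<And>p. 0 \<le> f p" "\<And>e. e \<in> edges H \<Longrightarrow> (\<Sum>p\<in>?I. a p e * f p) \<le> cap H e"
      "(\<Sum>p\<in>?I. \<delta> p * f p) = x * W"
    define D where "D P = (\<Sum>p\<in>paths_between H P. f p)" for P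
    have rt: "routes H T D f" using 7(1) by (simp add: routes_def D_def)
    have D0: "0 \<le> D P" for P using 7(1) by (simp add: D_def sum_nonneg)
    have dD: "(\<Sum>P\<in>terminal_pairs T. d P * D P) = x * W"
    proof -
      have "x * W = (\<Sum>P\<in>terminal_pairs T. \<Sum>p\<in>paths_between H P. \<delta> p * f p)"
        using 7(3) by (simp add: sum_terminal_paths H T)
      also have "\<dots> = (\<Sum>P\<in>terminal_pairs T. \<Sum>p\<in>paths_between H P. d P * f p)"
        by (intro sum.cong refl) (auto simp: \<delta>_def paths_between_def)
      finally show ?thesis by (simp add: D_def sum_distrib_left)
    qed
    have "edge_flow H T f e \<le> cap H e" if "e \<in> edges H" for e
    proof -
      have "edge_flow H T f e = (\<Sum>p\<in>?I. a p e * f p)"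
        unfolding edge_flow_def a_def using finI
        by (subst sum.inter_filter) (auto intro!: sum.cong)
      then show ?thesis using 7(2)[OF that] by simp
    qed
    then have "flow_congestion H T f \<le> 1"
      unfolding flow_congestion_def using H capH by (subst Max_le_iff) auto
    then have le1: "congestion H T D \<le> 1"
      unfolding congestion_def using rt by (intro INF_lower2[of f]) (auto simp: one_ereal_def)
    have "x \<le> congestion G T D"
      using dD W by (intro congestion_ge_dual[OF G T capG l dist]) auto
    moreover have "ereal x * congestion H T D \<le> ereal x * 1"
      using le1 x by (intro ereal_mult_left_mono) auto
    ultimately have ge: "ereal x * congestion H T D \<le> congestion G T D" by (simp add: order_trans)
    \<comment> \<open>The value \<open>x * W\<close> is positive, so some pair has positive demand;
      weak duality with unit lengths then makes the congestion in \<open>H\<close> positive.\<close>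
    have "\<exists>Q\<in>terminal_pairs T. 0 < D Q"
    proof (rule ccontr)
      assume "\<not> ?thesis"
      then have "D P = 0" if "P \<in> terminal_pairs T" for P
        using D0[of P] that by force
      then show False using dD K by auto
    qed
    then obtain Q where Q: "Q \<in> terminal_pairs T" "0 < D Q" by blast
    define W1 where "W1 = (\<Sum>e\<in>edges H. cap H e * 1)"
    have len: "1 \<le> (\<Sum>e\<in>set (snd p). 1::real)" if P: "P \<in> terminal_pairs T" "p \<in> paths_between H P" for P p
    proof -
      have "snd p \<noteq> []"
      proof
        assume "snd p = []"
        then have "length (fst p) = Suc 0" using P by (auto simp: paths_between_def is_path_def)
        then obtain v where "fst p = [v]" by (metis length_0_conv length_Suc_conv)
        then have "P = {v}" using P by (simp add: paths_between_def)
        then show False using P by (simp add: terminal_pairs_def)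
      qed
      then have "0 < card (set (snd p))" by (simp add: card_gt_0_iff)
      then show ?thesis by simp
    qed
    have "0 < (\<Sum>P\<in>terminal_pairs T. D P)"
      using Q D0 finite_terminal_pairs[OF T] by (intro sum_pos2[of _ Q]) auto
    have ne: "edges H \<noteq> {}"
    proof
      assume "edges H = {}"
      moreover have "paths_between H Q \<noteq> {}" using Q(2) by (auto simp: D_def)
      then obtain p where "p \<in> paths_between H Q" by auto
      moreover have "set (snd p) \<subseteq> edges H"
        using \<open>p \<in> _\<close> Q(1) by (intro sub) (auto simp: terminal_paths_def)
      ultimately show False using len[OF Q(1)] by fastforce
    qed
    then have W1: "0 < W1" unfolding W1_def using capH H by (intro sum_pos) auto
    have "ereal ((\<Sum>P\<in>terminal_pairs T. D P) / W1) \<le> congestion H T D"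
      using W1 len by (intro congestion_ge_dual[OF H T capH, of "\<lambda>_. 1" "\<lambda>_. 1"]) (auto simp: W1_def)
    moreover have "0 < ereal ((\<Sum>P\<in>terminal_pairs T. D P) / W1)"
      using W1 \<open>0 < (\<Sum>P\<in>terminal_pairs T. D P)\<close> by simp
    ultimately have "0 < congestion H T D" by (rule less_le_trans[rotated])
    moreover have "congestion H T D < \<infinity>" using le1 by auto
    moreover have "demand_on T D" using D0 by (simp add: demand_on_def)
    ultimately show ?thesis using ge by blast
  qed (use K d capH in \<open>auto simp: a_def \<delta>_def less_imp_le\<close>)
qed

section \<open>Distance potentials and contractions\<close>

lemma is_path_prefix:
  assumes "is_path H (vs, es)" "n \<le> length es"
  shows "is_path H (take (Suc n) vs, take n es)"
  using assms set_take_subset[of "Suc n" vs] set_take_subset[of n es]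
  by (auto simp: is_path_def)

lemma is_path_snoc:
  assumes "is_path H (vs, es)" "e \<in> edges H" "ends H e = {last vs, y}" "y \<in> verts H" "y \<notin> set vs"
  shows "is_path H (vs @ [y], es @ [e])"
proof -
  have len: "length vs = Suc (length es)" using assms(1) by (simp add: is_path_def)
  have "last vs = vs ! length es" using len last_conv_nth[of vs] by (cases vs) simp_all
  then show ?thesis using assms len by (auto simp: is_path_def nth_append less_Suc_eq)
qed

text \<open>The potential is the distance from \<open>s\<close> capped at \<open>M\<close>, which
  also gives unreachable vertices a value. Because of the cap, only distance bounds
  \<open>b \<le> M\<close> are inherited.\<close>

lemma exists_distance_potential:
  fixes l :: "'e \<Rightarrow> real" and M :: real
  assumes fin: "finite (verts H)" "finite (edges H)" and l: "\<And>e. 0 \<le> l e" and s: "s \<in> verts H" and M: "0 \<le> M"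
  shows "\<exists>\<phi> :: 'v \<Rightarrow> real. \<phi> s = 0 \<and> (\<forall>x. 0 \<le> \<phi> x \<and> \<phi> x \<le> M) \<and>
    (\<forall>e\<in>edges H. \<forall>x\<in>verts H. \<forall>y\<in>verts H. ends H e = {x, y} \<longrightarrow> \<bar>\<phi> y - \<phi> x\<bar> \<le> l e) \<and>
    (\<forall>t b. b \<le> M \<longrightarrow> (\<forall>p\<in>paths_between H {s, t}. b \<le> (\<Sum>e\<in>set (snd p). l e)) \<longrightarrow> b \<le> \<phi> t)"
proof -
  define Ps where "Ps x = {p. is_path H p \<and> hd (fst p) = s \<and> last (fst p) = x}" for x
  define len where "len p = (\<Sum>e\<in>set (snd p). l e)" for p :: "('v, 'e) path"
  define \<phi> where "\<phi> x = Min (insert M (len ` Ps x))" for x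
  have finP: "finite (Ps x)" for x
    by (rule finite_subset[OF _ finite_is_path[OF fin]]) (auto simp: Ps_def)
  have len0: "0 \<le> len p" for p by (simp add: len_def l sum_nonneg)
  have le: "\<phi> x \<le> len p" if "p \<in> Ps x" for p x
    unfolding \<phi>_def using finP that by (intro Min_le) auto
  have leM: "\<phi> x \<le> M" for x unfolding \<phi>_def using finP by (intro Min_le) auto
  have attained: "\<phi> x \<in> insert M (len ` Ps x)" for x
    unfolding \<phi>_def using finP by (intro Min_in) auto
  have pos: "0 \<le> \<phi> x" for x using attained[of x] M len0 by auto
  have "([s], []) \<in> Ps s" using s by (simp add: Ps_def is_path_def)
  from le[OF this] pos[of s] have \<phi>s: "\<phi> s = 0" by (simp add: len_def)
  have step: "\<phi> y \<le> \<phi> x + l e" if e: "e \<in> edges H" "ends H e = {x, y}" "y \<in> verts H" for e x y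
  proof -
    consider "\<phi> x = M" | p where "p \<in> Ps x" "\<phi> x = len p" using attained[of x] by auto
    then show ?thesis
    proof cases
      case 1
      then show ?thesis using leM[of y] l[of e] by simp
    next
      case (2 p)
      obtain vs es where p: "p = (vs, es)" by (cases p)
      have path: "is_path H (vs, es)" "hd vs = s" "last vs = x" using 2 by (auto simp: Ps_def p)
      have lens: "length vs = Suc (length es)" using path(1) by (simp add: is_path_def)
      then have ne: "vs \<noteq> []" by auto
      show ?thesis
      \<comment> \<open>Paths are simple: if \<open>y\<close> already lies on the path, the path is
        cut there instead of being extended.\<close>
      proof (cases "y \<in> set vs")
        case True
        then obtain n where n: "n < length vs" "vs ! n = y" by (auto simp: in_set_conv_nth)
        let ?q = "(take (Suc n) vs, take n es)"
        have "hd (take (Suc n) vs) = s" "last (take (Suc n) vs) = y"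
          using n path(2) by (simp_all add: hd_take) (simp add: take_Suc_conv_app_nth)
        then have "?q \<in> Ps y"
          using is_path_prefix[OF path(1), of n] n lens by (simp add: Ps_def)
        then have "\<phi> y \<le> len ?q" by (rule le)
        also have "\<dots> \<le> len p" unfolding len_def p using l
          by (intro sum_mono2) (auto dest: in_set_takeD)
        finally show ?thesis using 2 l[of e] by simp
      next
        case False
        have "(vs @ [y], es @ [e]) \<in> Ps y"
          using is_path_snoc[OF path(1) e(1), of y] e path False ne by (simp add: Ps_def)
        then have "\<phi> y \<le> len (vs @ [y], es @ [e])" by (rule le)
        also have "\<dots> \<le> len p + l e"
          unfolding len_def p using l[of e] by (cases "e \<in> set es") (simp_all add: insert_absorb)
        finally show ?thesis using 2 by simp
      qed
    qed
  qed
  have lip: "\<bar>\<phi> y - \<phi> x\<bar> \<le> l e" if "e \<in> edges H" "x \<in> verts H" "y \<in> verts H" "ends H e = {x, y}" for e x y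
    using step[of e x y] step[of e y x] that by (auto simp: insert_commute)
  have far: "b \<le> \<phi> t" if "b \<le> M" "\<forall>p\<in>paths_between H {s, t}. b \<le> len p" for t b
    using attained[of t] that by (auto simp: Ps_def paths_between_def)
  show ?thesis using \<phi>s pos leM lip far unfolding len_def by (intro exI[of _ \<phi>]) auto
qed

section \<open>Partitions and contracted graphs\<close>

lemma part_of_eq:
  assumes "partition_on V F" "P \<in> F" "x \<in> P"
  shows "part_of F x = P"
  unfolding part_of_def
proof (rule the_equality)
  show "Q = P" if "Q \<in> F \<and> x \<in> Q" for Q
    using disjointD[OF partition_onD2[OF assms(1)]] assms that by blast
qed (use assms in simp)

lemma part_of_partition:
  assumes "partition_on V F" "x \<in> V"
  shows "part_of F x \<in> F" "x \<in> part_of F x"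
proof -
  obtain P where "P \<in> F" "x \<in> P" using partition_onD1[OF assms(1)] assms(2) by blast
  then show "part_of F x \<in> F" "x \<in> part_of F x" using part_of_eq[OF assms(1)] by simp_all
qed

text \<open>The part of \<open>t\<close> contains no other terminal, which forces the choice in
  \<open>part_vertex\<close>.\<close>

lemma part_vertex_terminal:
  assumes "partition_on V F" "T \<subseteq> V" "t \<in> T"
    and "\<forall>P\<in>F. \<forall>t\<in>P \<inter> T. \<forall>t'\<in>P \<inter> T. t = t'"
  shows "part_vertex T (part_of F t) = t"
proof -
  note P = part_of_partition[OF assms(1), of t]
  have t: "t \<in> part_of F t \<inter> T" "part_of F t \<in> F" using P assms by auto
  then have "\<exists>v. v \<in> part_of F t \<and> (part_of F t \<inter> T \<noteq> {} \<longrightarrow> v \<in> T)" by auto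
  from someI_ex[OF this, folded part_vertex_def] have "part_vertex T (part_of F t) \<in> part_of F t \<inter> T"
    using t by auto
  then show ?thesis using assms(4) t by blast
qed

lemma contract_verts:
  "partition_on (verts G) F \<Longrightarrow> x \<in> verts G \<Longrightarrow> part_vertex T (part_of F x) \<in> verts (contract G T F)"
  by (auto simp: contract_def dest: part_of_partition)

text \<open>The ends of a discarded edge are merged, so it can be treated as an edge of length
  zero.\<close>

lemma contract_discarded:
  assumes "partition_on (verts G) F" "e \<in> edges G" "e \<notin> edges (contract G T F)" "ends G e = {x, y}"
  shows "part_of F x = part_of F y"
  using assms part_of_eq[OF assms(1)] by (auto simp: contract_def)

lemma finite_contract:
  assumes "partition_on (verts G) F" "finite (verts G)" "finite (edges G)"
  shows "finite (verts (contract G T F))" "finite (edges (contract G T F))"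
  using assms finite_elements[OF assms(2,1)] by (auto simp: contract_def)

section \<open>Staircase functions\<close>

text \<open>\<open>W\<close> indexes parallel lines. With \<open>\<bar>b - a\<bar>\<close> for
  \<open>\<rho>\<close> this is the variation seen at scale \<open>s\<close>; with the discrete
  metric it counts the intervals of length \<open>s\<close> whose ends have different
  values.\<close>

definition shift_sum :: "'w set \<Rightarrow> nat \<Rightarrow> (real \<Rightarrow> real \<Rightarrow> real) \<Rightarrow> ('w \<Rightarrow> nat \<Rightarrow> real) \<Rightarrow> nat \<Rightarrow> real" where
  "shift_sum W m \<rho> f s = (\<Sum>w\<in>W. \<Sum>i\<le>m - s. \<rho> (f w i) (f w (i + s)))"

lemma sum_shift_le:
  fixes a :: "nat \<Rightarrow> real"
  assumes "k + s \<le> n" "\<And>i. i \<le> n \<Longrightarrow> 0 \<le> a i"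
  shows "(\<Sum>i\<le>k. a (i + s)) \<le> (\<Sum>i\<le>n. a i)"
proof -
  have "(\<Sum>i\<le>k. a (i + s)) = (\<Sum>i\<in>(\<lambda>i. i + s) ` {..k}. a i)"
    by (subst sum.reindex) (auto simp: inj_on_def)
  also have "\<dots> \<le> (\<Sum>i\<le>n. a i)"
    using assms by (intro sum_mono2) auto
  finally show ?thesis .
qed

text \<open>An interval of length \<open>2 * s\<close> consists of two of length \<open>s\<close>,
  and each of these is used at most twice.\<close>

lemma shift_sum_double:
  assumes nonneg: "\<And>a b. 0 \<le> \<rho> a b" and tri: "\<And>a b c. \<rho> a c \<le> \<rho> a b + \<rho> b c"
    and s: "2 * s \<le> m"
  shows "shift_sum W m \<rho> f (2 * s) \<le> 2 * shift_sum W m \<rho> f s"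
proof -
  have "(\<Sum>i\<le>m - 2 * s. \<rho> (f w i) (f w (i + 2 * s))) \<le> 2 * (\<Sum>i\<le>m - s. \<rho> (f w i) (f w (i + s)))" for w
  proof -
    let ?a = "\<lambda>i. \<rho> (f w i) (f w (i + s))"
    have "(\<Sum>i\<le>m - 2 * s. \<rho> (f w i) (f w (i + 2 * s))) \<le> (\<Sum>i\<le>m - 2 * s. ?a (i + 0) + ?a (i + s))"
      using tri by (intro sum_mono) (simp add: mult_2 add.assoc)
    also have "\<dots> \<le> (\<Sum>i\<le>m - s. ?a i) + (\<Sum>i\<le>m - s. ?a i)"
      unfolding sum.distrib using s nonneg by (intro add_mono sum_shift_le) auto
    finally show ?thesis by simp
  qed
  then show ?thesis by (simp add: shift_sum_def sum_distrib_left sum_mono)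
qed

lemma shift_sum_power2:
  assumes "\<And>a b. 0 \<le> \<rho> a b" "\<And>a b c. \<rho> a c \<le> \<rho> a b + \<rho> b c" "2 ^ (a + b) \<le> m"
  shows "shift_sum W m \<rho> f (2 ^ (a + b)) \<le> 2 ^ b * shift_sum W m \<rho> f (2 ^ a)"
  using assms(3)
proof (induction b)
  case (Suc b)
  have "shift_sum W m \<rho> f (2 * 2 ^ (a + b)) \<le> 2 * shift_sum W m \<rho> f (2 ^ (a + b))"
    using Suc.prems by (intro shift_sum_double assms) auto
  also have "\<dots> \<le> 2 * (2 ^ b * shift_sum W m \<rho> f (2 ^ a))" using Suc by simp
  finally show ?case by simp
qed simp

section \<open>Running maxima\<close>

definition running_max :: "(nat \<Rightarrow> real) \<Rightarrow> nat \<Rightarrow> real" where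
  "running_max f i = Max (f ` {..i})"

lemma running_max_0: "running_max f 0 = f 0"
  by (simp add: running_max_def)

lemma running_max_Suc: "running_max f (Suc i) = max (running_max f i) (f (Suc i))"
  unfolding running_max_def atMost_Suc image_insert by (subst Max_insert) (auto simp: max.commute)

lemma running_max_ge: "f i \<le> running_max f i"
  unfolding running_max_def by (rule Max_ge) auto

lemma running_max_mono: "i \<le> j \<Longrightarrow> running_max f i \<le> running_max f j"
  by (rule lift_Suc_mono_le[of "running_max f"]) (auto simp: running_max_Suc)

lemma running_max_in: "running_max f i \<in> f ` {..i}"
  unfolding running_max_def by (rule Max_in) auto

text \<open>The difference \<open>f - running_max f\<close> starts at 0, is never positive and falls
  by at most \<open>\<nu> i\<close> in step \<open>i\<close>. Its total rise is therefore at most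
  its total fall.\<close>

lemma running_max_variation:
  assumes "\<And>i. i < m \<Longrightarrow> f i - \<nu> i \<le> f (Suc i)" "\<And>i. i < m \<Longrightarrow> 0 \<le> \<nu> i"
  shows "(\<Sum>i<m. \<bar>(f (Suc i) - running_max f (Suc i)) - (f i - running_max f i)\<bar>) \<le> 2 * (\<Sum>i<m. \<nu> i)"
proof -
  let ?e = "\<lambda>i. f i - running_max f i"
  have "(\<Sum>i<m. \<bar>?e (Suc i) - ?e i\<bar>) \<le> (\<Sum>i<m. (?e (Suc i) - ?e i) + 2 * \<nu> i)"
  proof (rule sum_mono)
    fix i assume "i \<in> {..<m}"
    then show "\<bar>?e (Suc i) - ?e i\<bar> \<le> (?e (Suc i) - ?e i) + 2 * \<nu> i"
      using assms[of i] running_max_ge[of f i] by (simp add: running_max_Suc)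
  qed
  also have "\<dots> = ?e m - ?e 0 + 2 * (\<Sum>i<m. \<nu> i)"
    using sum_lessThan_telescope[of ?e m] by (simp add: sum.distrib sum_distrib_left)
  also have "\<dots> \<le> 2 * (\<Sum>i<m. \<nu> i)" using running_max_ge[of f m] by (simp add: running_max_0)
  finally show ?thesis .
qed

text \<open>The value reached by a jump is a value of \<open>f\<close>, and later jumps reach larger
  values.\<close>

lemma card_jumps_running_max:
  assumes "card (f ` {..m}) \<le> N"
  shows "card {i. i < m \<and> running_max f i \<noteq> running_max f (Suc i)} \<le> N"
proof -
  let ?g = "running_max f" and ?J = "{i. i < m \<and> running_max f i \<noteq> running_max f (Suc i)}"
  have "inj_on (\<lambda>i. ?g (Suc i)) ?J"
  proof (rule linorder_inj_onI)
    fix i j assume "i < j" "i \<in> ?J" "j \<in> ?J"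
    then have "?g (Suc i) \<le> ?g j" "?g j < ?g (Suc j)"
      using running_max_mono[of "Suc i" j f] running_max_mono[of j "Suc j" f] by auto
    then show "?g (Suc i) \<noteq> ?g (Suc j)" by simp
  qed auto
  moreover have "(\<lambda>i. ?g (Suc i)) ` ?J \<subseteq> f ` {..m}"
  proof clarify
    fix i assume "i < m"
    then show "?g (Suc i) \<in> f ` {..m}" using running_max_in[of f "Suc i"] by auto
  qed
  ultimately have "card ?J \<le> card (f ` {..m})" by (intro card_inj_on_le) auto
  then show ?thesis using assms by simp
qed

text \<open>A staircase with few values has, at some dyadic scale, almost no two adjacent intervals that
  both contain a jump; at that scale its second differences are as large as its first differences.\<close>

lemma few_values_second_differences:
  fixes f :: "'w \<Rightarrow> nat \<Rightarrow> real" and \<nu> :: "'w \<Rightarrow> nat \<Rightarrow> real"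
  assumes W: "finite W"
    and second: "\<And>s. s \<le> 2 ^ \<kappa> \<Longrightarrow>
      (\<Sum>w\<in>W. \<Sum>i\<le>m - 2 * s. \<bar>f w (i + 2 * s) - 2 * f w (i + s) + f w i\<bar>) \<le> 12 * real s * E"
    and \<nu>: "\<And>w i. w \<in> W \<Longrightarrow> i < m \<Longrightarrow> f w i - \<nu> w i \<le> f w (Suc i)"
      "\<And>w i. w \<in> W \<Longrightarrow> i < m \<Longrightarrow> 0 \<le> \<nu> w i" "(\<Sum>w\<in>W. \<Sum>i<m. \<nu> w i) \<le> E"
    and range: "\<And>w i. w \<in> W \<Longrightarrow> i \<le> m \<Longrightarrow> 0 \<le> f w i \<and> f w i \<le> C"
    and few: "\<And>w. w \<in> W \<Longrightarrow> card (f w ` {..m}) \<le> N"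
    and m: "2 ^ (\<kappa> + 2) \<le> m"
    and top: "2 ^ (\<kappa> + 2) * \<tau> \<le> shift_sum W m (\<lambda>a b. \<bar>b - a\<bar>) f (2 ^ (\<kappa> + 2))"
    and \<delta>: "0 \<le> \<delta>" "\<delta> \<le> 1" "18 * E + 2 * \<delta> * C * N * card W < \<tau>"
    and \<kappa>: "(1 - \<delta>) ^ \<kappa> * N * card W * C < \<tau> - 2 * E"
    and C: "0 \<le> C"
  shows False
proof -
  \<comment> \<open>An increasing staircase with at most \<open>N\<close> jumps on each line; its
    difference to \<open>f\<close> has total variation at most \<open>2 * E\<close>.\<close>
  define g where "g w = running_max (f w)" for w
  define T where "T = shift_sum W m (\<lambda>a b. \<bar>b - a\<bar>)"
  define A where "A = shift_sum W m (\<lambda>a b. of_bool (b \<noteq> a)) g"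
  have T2: "T u (2 ^ (a + b)) \<le> 2 ^ b * T u (2 ^ a)" if "2 ^ (a + b) \<le> m" for u a b
    unfolding T_def using that by (intro shift_sum_power2) auto
  have A2: "A (2 ^ (a + b)) \<le> 2 ^ b * A (2 ^ a)" if "2 ^ (a + b) \<le> m" for a b
    unfolding A_def using that by (intro shift_sum_power2) auto
  have km: "2 ^ a \<le> m" if "a \<le> \<kappa> + 2" for a
    using power_increasing[of a "\<kappa> + 2" "2::nat"] that m by simp
  have m0: "m - 1 = m - Suc 0" "{..m - Suc 0} = {..<m}" using km[of 0] by auto
  have A1: "A 1 \<le> N * card W"
  proof -
    have "(\<Sum>i\<le>m - 1. of_bool (g w (i + 1) \<noteq> g w i)) \<le> real N" if "w \<in> W" for w
    proof -
      have "(\<Sum>i\<le>m - 1. of_bool (g w (i + 1) \<noteq> g w i)) = (\<Sum>i<m. of_bool (g w i \<noteq> g w (Suc i)))"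
        unfolding m0 by (intro sum.cong) auto
      also have "\<dots> = real (card {i. i < m \<and> g w i \<noteq> g w (Suc i)})"
        by (simp add: sum_of_bool_eq Int_def)
      finally show ?thesis using card_jumps_running_max[OF few[OF that]] by (simp add: g_def)
    qed
    then have "A 1 \<le> (\<Sum>w\<in>W. real N)" unfolding A_def shift_sum_def by (intro sum_mono)
    then show ?thesis by (simp add: mult.commute)
  qed
  have gin: "g w i \<in> f w ` {..i}" for w i unfolding g_def by (rule running_max_in)
  have grange: "0 \<le> g w i \<and> g w i \<le> C" if "w \<in> W" "i \<le> m" for w i
    using gin[of w i] range[OF that(1)] that(2) by fastforce
  have gmono: "g w i \<le> g w j" if "i \<le> j" for w i j using running_max_mono[OF that] by (simp add: g_def)
  define e where "e w i = f w i - g w i" for w i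
  have e1: "T e 1 \<le> 2 * E"
  proof -
    have "(\<Sum>i\<le>m - 1. \<bar>e w (i + 1) - e w i\<bar>) \<le> 2 * (\<Sum>i<m. \<nu> w i)" if "w \<in> W" for w
      using running_max_variation[of m "f w" "\<nu> w"] \<nu>(1,2)[OF that] unfolding m0
      by (simp add: e_def g_def)
    then have "T e 1 \<le> (\<Sum>w\<in>W. 2 * (\<Sum>i<m. \<nu> w i))" unfolding T_def shift_sum_def by (intro sum_mono)
    also have "\<dots> \<le> 2 * E" using \<nu>(3) by (simp add: sum_distrib_left[symmetric])
    finally show ?thesis .
  qed
  have es: "T e (2 ^ a) \<le> 2 ^ a * (2 * E)" if "a \<le> \<kappa>" for a
  proof -
    have "T e (2 ^ a) \<le> 2 ^ a * T e 1" using T2[of 0 a e] km[of a] that by simp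
    also have "\<dots> \<le> 2 ^ a * (2 * E)" using e1 by simp
    finally show ?thesis .
  qed
  \<comment> \<open>The variation assumed at the top scale passes down to all smaller dyadic scales,
    because doubling the scale at most doubles \<open>T\<close>.\<close>
  have Tf: "2 ^ a * \<tau> \<le> T f (2 ^ a)" if "a \<le> \<kappa>" for a
  proof -
    have "2 ^ (\<kappa> + 2) * \<tau> \<le> 2 ^ (\<kappa> + 2 - a) * T f (2 ^ a)"
      using order_trans[OF top[folded T_def]] T2[of a "\<kappa> + 2 - a" f] that m by simp
    moreover have "(2::real) ^ (\<kappa> + 2) = 2 ^ (\<kappa> + 2 - a) * 2 ^ a" using that by (simp flip: power_add)
    ultimately show ?thesis by simp
  qed
  have Tsub: "T f s \<le> T g s + T e s" for s
    unfolding T_def shift_sum_def sum.distrib[symmetric] by (intro sum_mono) (auto simp: e_def)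
  have Tg: "2 ^ a * (\<tau> - 2 * E) \<le> T g (2 ^ a)" if "a \<le> \<kappa>" for a
    using Tf[OF that] es[OF that] Tsub[of "2 ^ a"] by (simp add: algebra_simps)
  have TA: "T g s \<le> C * A s" if "s \<le> m" for s
    unfolding T_def A_def shift_sum_def sum_distrib_left
  proof (intro sum_mono)
    fix w i assume "w \<in> W" "i \<in> {..m - s}"
    then have "i \<le> m" "i + s \<le> m" using that by auto
    then show "\<bar>g w (i + s) - g w i\<bar> \<le> C * of_bool (g w (i + s) \<noteq> g w i)"
      using grange[OF \<open>w \<in> W\<close>, of i] grange[OF \<open>w \<in> W\<close>, of "i + s"] by (auto simp: abs_if)
  qed
  \<comment> \<open>Pigeonhole over scales: if doubling the scale always multiplied \<open>A\<close>
    by at most \<open>2 - 2 * \<delta>\<close>, too few intervals of length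
    \<open>2 ^ \<kappa>\<close> would see a change to carry the variation \<open>T g\<close>, as
    each contributes at most \<open>C\<close>.\<close>
  have "\<exists>a<\<kappa>. (2 - 2 * \<delta>) * A (2 ^ a) \<le> A (2 ^ Suc a)"
  proof (rule ccontr)
    assume "\<not> ?thesis"
    then have dec: "A (2 ^ Suc a) \<le> (2 - 2 * \<delta>) * A (2 ^ a)" if "a < \<kappa>" for a
      using that by (meson linear)
    have "A (2 ^ b) \<le> (2 - 2 * \<delta>) ^ b * A 1" if "b \<le> \<kappa>" for b
      using that
    proof (induction b)
      case (Suc b)
      have "A (2 ^ Suc b) \<le> (2 - 2 * \<delta>) * A (2 ^ b)" using Suc.prems by (intro dec) simp
      also have "\<dots> \<le> (2 - 2 * \<delta>) * ((2 - 2 * \<delta>) ^ b * A 1)"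
        using Suc \<delta> by (intro mult_left_mono) auto
      finally show ?case by simp
    qed simp
    then have "A (2 ^ \<kappa>) \<le> (2 - 2 * \<delta>) ^ \<kappa> * A 1" by simp
    also have "\<dots> \<le> (2 - 2 * \<delta>) ^ \<kappa> * (N * card W)" using A1 \<delta> by (intro mult_left_mono) auto
    also have "(2 - 2 * \<delta>) ^ \<kappa> = 2 ^ \<kappa> * (1 - \<delta>) ^ \<kappa>" by (simp add: power_mult_distrib[symmetric] algebra_simps)
    finally have "C * A (2 ^ \<kappa>) \<le> C * (2 ^ \<kappa> * (1 - \<delta>) ^ \<kappa> * (N * card W))" using C by (rule mult_left_mono)
    also have "\<dots> = 2 ^ \<kappa> * ((1 - \<delta>) ^ \<kappa> * N * card W * C)" by (simp add: algebra_simps)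
    also have "\<dots> < 2 ^ \<kappa> * (\<tau> - 2 * E)" using \<kappa> by simp
    finally show False using Tg[of \<kappa>] TA[of "2 ^ \<kappa>"] km[of \<kappa>] by simp
  qed
  then obtain a where a: "a < \<kappa>" "(2 - 2 * \<delta>) * A (2 ^ a) \<le> A (2 ^ Suc a)" by blast
  define s :: nat where "s = 2 ^ a"
  have s: "4 * s \<le> m" "s \<le> 2 ^ \<kappa>" "0 < s"
    using km[of "a + 2"] a(1) by (auto simp: s_def power_add)
  define both where "both w i = (of_bool (g w (i + s) \<noteq> g w i \<and> g w (i + 2 * s) \<noteq> g w (i + s)) :: real)" for w i
  \<comment> \<open>Since \<open>4 * s \<le> m\<close>, every interval of length \<open>s\<close> is
    the first or second half of an admissible interval of length \<open>2 * s\<close>.\<close>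
  have cover: "(\<Sum>i\<le>m - s. u i) \<le> (\<Sum>i\<le>m - 2 * s. u i + u (i + s))"
    if "\<And>i. i \<le> m - s \<Longrightarrow> 0 \<le> u i" for u :: "nat \<Rightarrow> real"
  proof -
    have "(\<Sum>i\<le>m - s. u i) \<le> (\<Sum>i\<in>{..m - 2 * s} \<union> (\<lambda>i. i + s) ` {..m - 2 * s}. u i)"
    proof (rule sum_mono2)
      show "{..m - s} \<subseteq> {..m - 2 * s} \<union> (\<lambda>i. i + s) ` {..m - 2 * s}"
      proof
        fix i assume "i \<in> {..m - s}"
        then have "i \<le> m - 2 * s \<or> i = (i - s) + s \<and> i - s \<in> {..m - 2 * s}" using s by auto
        then show "i \<in> {..m - 2 * s} \<union> (\<lambda>i. i + s) ` {..m - 2 * s}" by auto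
      qed
      show "0 \<le> u i" if "i \<in> {..m - 2 * s} \<union> (\<lambda>i. i + s) ` {..m - 2 * s} - {..m - s}" for i
        using that s by auto
    qed auto
    also have "\<dots> \<le> (\<Sum>i\<le>m - 2 * s. u i) + (\<Sum>i\<in>(\<lambda>i. i + s) ` {..m - 2 * s}. u i)"
      using that s by (subst sum.union_inter[symmetric]) (auto intro!: sum_nonneg)
    also have "(\<Sum>i\<in>(\<lambda>i. i + s) ` {..m - 2 * s}. u i) = (\<Sum>i\<le>m - 2 * s. u (i + s))"
      by (subst sum.reindex) (auto simp: inj_on_def)
    finally show ?thesis by (simp add: sum.distrib)
  qed
  \<comment> \<open>An interval of length \<open>2 * s\<close> that changes in both halves is
    counted twice through its halves, but at most once by itself.\<close>
  have bothA: "(\<Sum>w\<in>W. \<Sum>i\<le>m - 2 * s. both w i) \<le> 2 * A s - A (2 * s)"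
  proof -
    let ?a = "\<lambda>w i. of_bool (g w (i + s) \<noteq> g w i) :: real"
    have "(\<Sum>w\<in>W. \<Sum>i\<le>m - 2 * s. both w i) + A (2 * s) \<le>
        (\<Sum>w\<in>W. \<Sum>i\<le>m - 2 * s. ?a w (i + 0) + ?a w (i + s))"
      unfolding A_def shift_sum_def sum.distrib[symmetric]
      by (intro sum_mono) (auto simp: both_def mult_2 add.assoc)
    also have "\<dots> \<le> (\<Sum>w\<in>W. (\<Sum>i\<le>m - s. ?a w i) + (\<Sum>i\<le>m - s. ?a w i))"
      unfolding sum.distrib using s by (intro add_mono sum_mono sum_shift_le) auto
    also have "\<dots> = 2 * A s" by (simp add: A_def shift_sum_def sum_distrib_left)
    finally show ?thesis by simp
  qed
  have Sg: "(\<Sum>w\<in>W. \<Sum>i\<le>m - 2 * s. \<bar>g w (i + 2 * s) - 2 * g w (i + s) + g w i\<bar>) \<le> 12 * real s * E + 2 * T e s"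
  proof -
    let ?a = "\<lambda>w i. \<bar>e w (i + s) - e w i\<bar>"
    have "(\<Sum>w\<in>W. \<Sum>i\<le>m - 2 * s. \<bar>g w (i + 2 * s) - 2 * g w (i + s) + g w i\<bar>) \<le>
       (\<Sum>w\<in>W. \<Sum>i\<le>m - 2 * s. \<bar>f w (i + 2 * s) - 2 * f w (i + s) + f w i\<bar> + (?a w (i + 0) + ?a w (i + s)))"
    proof (intro sum_mono)
      fix w i
      have ii: "i + s + s = i + 2 * s" by simp
      have "g w (i + 2 * s) - 2 * g w (i + s) + g w i = (f w (i + 2 * s) - 2 * f w (i + s) + f w i) -
          ((e w (i + s + s) - e w (i + s)) - (e w (i + s) - e w i))"
        unfolding e_def ii by (simp add: algebra_simps)
      then show "\<bar>g w (i + 2 * s) - 2 * g w (i + s) + g w i\<bar> \<le>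
          \<bar>f w (i + 2 * s) - 2 * f w (i + s) + f w i\<bar> + (?a w (i + 0) + ?a w (i + s))"
        unfolding add_0_right by linarith
    qed
    also have "\<dots> \<le> 12 * real s * E + (\<Sum>w\<in>W. (\<Sum>i\<le>m - s. ?a w i) + (\<Sum>i\<le>m - s. ?a w i))"
      unfolding sum.distrib using s by (intro add_mono sum_mono sum_shift_le second) auto
    also have "(\<Sum>w\<in>W. (\<Sum>i\<le>m - s. ?a w i) + (\<Sum>i\<le>m - s. ?a w i)) = 2 * T e s"
      by (simp add: T_def shift_sum_def sum_distrib_left)
    finally show ?thesis .
  qed
  have "T g s \<le> (\<Sum>w\<in>W. \<Sum>i\<le>m - 2 * s. \<bar>g w (i + s) - g w i\<bar> + \<bar>g w (i + s + s) - g w (i + s)\<bar>)"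
    unfolding T_def shift_sum_def using cover[of "\<lambda>i. \<bar>g w (i + s) - g w i\<bar>" for w] by (intro sum_mono) auto
  also have "\<dots> \<le> (\<Sum>w\<in>W. \<Sum>i\<le>m - 2 * s. \<bar>g w (i + 2 * s) - 2 * g w (i + s) + g w i\<bar> + C * both w i)"
  proof (intro sum_mono)
    fix w i assume w: "w \<in> W" and "i \<in> {..m - 2 * s}"
    then have i: "i \<le> m" "i + 2 * s \<le> m" using s by auto
    have ii: "i + s + s = i + 2 * s" by simp
    have mon: "g w i \<le> g w (i + s)" "g w (i + s) \<le> g w (i + 2 * s)" by (auto intro: gmono)
    have gC: "g w (i + 2 * s) - g w i \<le> C" using grange[OF w i(1)] grange[OF w i(2)] by simp
    then show "\<bar>g w (i + s) - g w i\<bar> + \<bar>g w (i + s + s) - g w (i + s)\<bar> \<le>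
        \<bar>g w (i + 2 * s) - 2 * g w (i + s) + g w i\<bar> + C * both w i"
    \<comment> \<open>As \<open>g\<close> is increasing, the second difference is the whole rise up
      to sign if one half is constant. Otherwise the rise is at most \<open>C\<close>.\<close>
    proof (cases "g w (i + s) \<noteq> g w i \<and> g w (i + 2 * s) \<noteq> g w (i + s)")
      case True
      then have "C * both w i = C" by (simp add: both_def)
      then show ?thesis using mon gC unfolding ii by linarith
    next
      case False
      then have "C * both w i = 0" by (simp add: both_def)
      then show ?thesis using mon False unfolding ii by (smt (verit))
    qed
  qed
  also have "\<dots> \<le> 12 * real s * E + 2 * T e s + C * (2 * A s - A (2 * s))"
    unfolding sum.distrib sum_distrib_left[symmetric]
    using Sg bothA C by (intro add_mono mult_left_mono)
  also have "\<dots> \<le> 12 * real s * E + 2 * (real s * (2 * E)) + C * (2 * \<delta> * (real s * (N * card W)))"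
  proof (intro add_mono mult_left_mono C order_refl)
    show "T e s \<le> real s * (2 * E)" using es[of a] a(1) by (simp add: s_def)
    \<comment> \<open>At the chosen scale \<open>A\<close> almost doubles, so few intervals change
      in both halves.\<close>
    have "2 * A s - A (2 * s) \<le> 2 * \<delta> * A s" using a(2) by (simp add: s_def algebra_simps)
    also have "A s \<le> 2 ^ a * A 1" using A2[of 0 a] km[of a] a(1) by (simp add: s_def)
    also have "\<dots> \<le> real s * (N * card W)" using A1 by (simp add: s_def)
    finally show "2 * A s - A (2 * s) \<le> 2 * \<delta> * (real s * (N * card W))" using \<delta>(1) by (simp add: mult_left_mono)
  qed auto
  finally have "T g s \<le> real s * (16 * E + 2 * \<delta> * C * N * card W)" by (simp add: algebra_simps)
  moreover have "real s * (\<tau> - 2 * E) \<le> T g s" using Tg[of a] a(1) by (simp add: s_def)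
  ultimately have "real s * (\<tau> - 2 * E) \<le> real s * (16 * E + 2 * \<delta> * C * N * card W)" by linarith
  then have "\<tau> - 2 * E \<le> 16 * E + 2 * \<delta> * C * N * card W" using s(3) by simp
  with \<delta>(3) show False by simp
qed

section \<open>Rigidity of the lattice\<close>

text \<open>The point \<open>(i, j, k)\<close> stands for \<open>i (-1, 1, 1) + j (1, -1, 1) + k (1, 1, -1)\<close>, so that directions
  \<open>0\<close>, \<open>1\<close>, \<open>2\<close>, \<open>3\<close> are the four body diagonals; \<open>sg z c\<close> is coordinate \<open>c\<close> of direction \<open>z\<close>.\<close>

type_synonym point = "nat \<times> nat \<times> nat"

definition shift :: "nat \<Rightarrow> nat \<Rightarrow> point \<Rightarrow> point" where
  "shift z t = (\<lambda>(i, j, k). (i + (if z = 0 \<or> z = 3 then t else 0),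
     j + (if z = 1 \<or> z = 3 then t else 0), k + (if z = 2 \<or> z = 3 then t else 0)))"

definition box :: "nat \<Rightarrow> point set" where
  "box m = {..m} \<times> {..m} \<times> {..m}"

definition lat :: "nat \<Rightarrow> nat \<Rightarrow> point set" where
  "lat m z = {u \<in> box m. shift z 1 u \<in> box m}"

definition sg :: "nat \<Rightarrow> nat \<Rightarrow> real" where
  "sg z c = (if z = c then - 1 else 1)"

lemma finite_box [simp]: "finite (box m)" by (simp add: box_def)

lemma finite_lat [simp]: "finite (lat m z)" by (simp add: lat_def)

lemma shift_0 [simp]: "shift z 0 u = u" by (cases u) (simp add: shift_def)

lemma shift_shift [simp]: "shift z a (shift z b u) = shift z (a + b) u"
  by (cases u) (simp add: shift_def)

lemma shift_commute: "shift z a (shift z' b u) = shift z' b (shift z a u)"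
  by (cases u) (simp add: shift_def)

lemma inj_shift: "inj (shift z t)"
  by (rule injI) (auto simp: shift_def split: prod.splits)

lemma inj_on_shift: "inj_on p A \<Longrightarrow> inj_on (\<lambda>a. shift z t (p a)) A"
  unfolding inj_on_def by (blast dest: injD[OF inj_shift])

lemma shift_box: "shift z t u \<in> box m \<Longrightarrow> t' \<le> t \<Longrightarrow> shift z t' u \<in> box m"
  by (cases u) (auto simp: shift_def box_def split: if_splits)

lemma shift_lat: "shift z s u \<in> box m \<Longrightarrow> t < s \<Longrightarrow> shift z t u \<in> lat m z"
  using shift_box[of z s u m t] shift_box[of z s u m "Suc t"] by (simp add: lat_def)

text \<open>\<open>\<phi> c\<close> stands for the distance from \<open>s\<^sub>c\<close> and
  \<open>L\<close> for the lengths of lattice edges. That \<open>L\<close> does not depend on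
  \<open>c\<close> is what couples the three functions; \<open>E\<close> bounds the total failure of
  tightness.\<close>

locale nearly_tight =
  fixes h :: nat and \<phi> :: "nat \<Rightarrow> point \<Rightarrow> real" and L :: "nat \<Rightarrow> point \<Rightarrow> real" and E :: real
  assumes lip: "\<And>z c u. z < 4 \<Longrightarrow> c < 3 \<Longrightarrow> u \<in> lat (8 * h) z \<Longrightarrow> \<bar>\<phi> c (shift z 1 u) - \<phi> c u\<bar> \<le> L z u"
    and total: "(\<Sum>z<4. \<Sum>u\<in>lat (8 * h) z. \<Sum>c<3. L z u - sg z c * (\<phi> c (shift z 1 u) - \<phi> c u)) \<le> E"
begin

abbreviation "B \<equiv> box (8 * h)"

definition slack :: "nat \<Rightarrow> nat \<Rightarrow> point \<Rightarrow> real" where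
  "slack z c u = L z u - sg z c * (\<phi> c (shift z 1 u) - \<phi> c u)"

definition v :: "nat \<Rightarrow> point \<Rightarrow> real" where
  "v z u = (\<Sum>c<3. slack z c u)"

definition V :: "nat \<Rightarrow> nat \<Rightarrow> point \<Rightarrow> real" where
  "V z s u = (\<Sum>t<s. v z (shift z t u))"

definition X :: "nat \<Rightarrow> nat \<Rightarrow> point \<Rightarrow> real" where
  "X c s u = \<phi> c (shift 0 s u) - \<phi> c u"

lemma slack_nonneg: "z < 4 \<Longrightarrow> c < 3 \<Longrightarrow> u \<in> lat (8 * h) z \<Longrightarrow> 0 \<le> slack z c u"
  using lip[of z c u] by (auto simp: slack_def sg_def)

lemma slack_le_v: "z < 4 \<Longrightarrow> c < 3 \<Longrightarrow> u \<in> lat (8 * h) z \<Longrightarrow> slack z c u \<le> v z u"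
  unfolding v_def by (rule member_le_sum) (auto intro: slack_nonneg)

lemma v_nonneg: "z < 4 \<Longrightarrow> u \<in> lat (8 * h) z \<Longrightarrow> 0 \<le> v z u"
  unfolding v_def by (rule sum_nonneg) (auto intro: slack_nonneg)

lemma sum_v_le:
  assumes "z < 4"
  shows "(\<Sum>u\<in>lat (8 * h) z. v z u) \<le> E"
proof -
  have "(\<Sum>u\<in>lat (8 * h) z. v z u) \<le> (\<Sum>z<4. \<Sum>u\<in>lat (8 * h) z. v z u)"
    using assms by (intro member_le_sum[of z]) (auto intro!: sum_nonneg v_nonneg)
  then show ?thesis using total by (simp add: v_def slack_def)
qed

lemma E_nonneg: "0 \<le> E"
  using sum_v_le[of 0] sum_nonneg[of "lat (8 * h) 0" "v 0"] v_nonneg[of 0] by force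

text \<open>The lengths \<open>L\<close> of the edges passed cancel, and only the slacks of the two
  commodities remain.\<close>

lemma chain:
  assumes "z < 4" "c < 3" "c' < 3" "shift z s u \<in> B"
  shows "\<bar>sg z c * (\<phi> c (shift z s u) - \<phi> c u) - sg z c' * (\<phi> c' (shift z s u) - \<phi> c' u)\<bar> \<le> V z s u"
  using assms(4)
proof (induction s)
  case (Suc s)
  let ?x = "shift z s u"
  have x: "?x \<in> lat (8 * h) z" using Suc.prems by (rule shift_lat) simp
  have "shift z s u \<in> B" using shift_box[OF Suc.prems] by simp
  note IH = Suc.IH[OF this]
  have "\<bar>slack z c' ?x - slack z c ?x\<bar> \<le> v z ?x"
    using slack_le_v[OF assms(1,2) x] slack_le_v[OF assms(1,3) x]
      slack_nonneg[OF assms(1,2) x] slack_nonneg[OF assms(1,3) x] by linarith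
  moreover have "shift z 1 ?x = shift z (Suc s) u" by simp
  ultimately show ?case using IH unfolding slack_def V_def by (simp add: algebra_simps)
qed (simp add: V_def)

text \<open>Without slack, direction \<open>0\<close> gives \<open>X 1 = X 2 = - X 0\<close>, and in
  direction \<open>z\<close> commodity 0 changes by the same amount as one of the commodities 1 and
  2. Subtracting their closing relations around the parallelogram shows that \<open>2 * X 1\<close>
  is equal on the two sides parallel to direction \<open>0\<close>.\<close>

lemma parallelogram:
  assumes z: "z \<in> {1, 2, 3}" and b: "shift z t (shift 0 s u) \<in> B"
  shows "\<bar>X 1 s (shift z t u) - X 1 s u\<bar> \<le> V z t u + V z t (shift 0 s u) + V 0 s u + V 0 s (shift z t u)"
proof -
  have c: "shift 0 s (shift z t u) \<in> B" using b by (simp add: shift_commute)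
  have in1: "shift z t u \<in> B" and in2: "shift 0 s u \<in> B"
    using shift_box[OF c, of 0] shift_box[OF b, of 0] by simp_all
  have close: "X a s u + (\<phi> a (shift z t (shift 0 s u)) - \<phi> a (shift 0 s u)) =
      (\<phi> a (shift z t u) - \<phi> a u) + X a s (shift z t u)" for a
    by (simp add: X_def shift_commute)
  note c1 = chain[of 0 1 0 s u, OF _ _ _ in2] chain[of 0 1 2 s u, OF _ _ _ in2]
    chain[of 0 1 0 s "shift z t u", OF _ _ _ c] chain[of 0 1 2 s "shift z t u", OF _ _ _ c]
  show ?thesis
  proof (cases "z = 1")
    case True
    show ?thesis
      using c1 chain[of z 0 2 t u, OF _ _ _ in1] chain[of z 0 2 t "shift 0 s u", OF _ _ _ b]
        close[of 0] close[of 2] True by (simp add: sg_def X_def)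
  next
    case False
    then have "z = 2 \<or> z = 3" using z by auto
    then show ?thesis
      using c1 chain[of z 0 1 t u, OF _ _ _ in1] chain[of z 0 1 t "shift 0 s u", OF _ _ _ b]
        close[of 0] close[of 1] by (auto simp: sg_def X_def)
  qed
qed

text \<open>The segments are edge-disjoint, so every slack is counted at most once.\<close>

lemma sum_V_le:
  assumes z: "z < 4" and A: "finite A" "inj_on (\<lambda>(a, t). shift z t (p a)) (A \<times> {..<s})"
    and box: "\<And>a. a \<in> A \<Longrightarrow> shift z s (p a) \<in> B"
  shows "(\<Sum>a\<in>A. V z s (p a)) \<le> E"
proof -
  let ?q = "\<lambda>(a, t). shift z t (p a)"
  have "(\<Sum>a\<in>A. V z s (p a)) = (\<Sum>x\<in>A \<times> {..<s}. v z (?q x))"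
    unfolding V_def by (simp add: sum.cartesian_product split_def)
  also have "\<dots> = (\<Sum>u\<in>?q ` (A \<times> {..<s}). v z u)"
    by (simp only: sum.reindex[OF A(2)] o_def)
  also have "\<dots> \<le> (\<Sum>u\<in>lat (8 * h) z. v z u)"
    using z by (intro sum_mono2) (auto intro: v_nonneg shift_lat[OF box])
  also have "\<dots> \<le> E" using z by (rule sum_v_le)
  finally show ?thesis .
qed

text \<open>Segments may overlap here, but for each of the \<open>s\<close> offsets distinct
  starting points use distinct edges.\<close>

lemma sum_V_le_mult:
  assumes z: "z < 4" and A: "finite A" "inj_on p A"
    and box: "\<And>a. a \<in> A \<Longrightarrow> shift z s (p a) \<in> B"
  shows "(\<Sum>a\<in>A. V z s (p a)) \<le> s * E"
proof -
  have "(\<Sum>a\<in>A. V z s (p a)) = (\<Sum>t<s. \<Sum>a\<in>A. v z (shift z t (p a)))"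
    unfolding V_def by (rule sum.swap)
  also have "\<dots> \<le> (\<Sum>t<s. E)"
  proof (rule sum_mono)
    fix t assume t: "t \<in> {..<s}"
    have inj: "inj_on (\<lambda>a. shift z t (p a)) A" using A(2) by (rule inj_on_shift)
    have "(\<Sum>a\<in>A. v z (shift z t (p a))) = (\<Sum>u\<in>(\<lambda>a. shift z t (p a)) ` A. v z u)"
      by (simp only: sum.reindex[OF inj] o_def)
    also have "\<dots> \<le> (\<Sum>u\<in>lat (8 * h) z. v z u)"
      using z t by (intro sum_mono2) (auto intro: v_nonneg shift_lat[OF box])
    also have "\<dots> \<le> E" using z by (rule sum_v_le)
    finally show "(\<Sum>a\<in>A. v z (shift z t (p a))) \<le> E" .
  qed
  finally show ?thesis by simp
qed

text \<open>In direction \<open>0\<close>, the translate by \<open>s\<close> is reached through \<open>shift 3 s\<close>, followed by the inverses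
  of \<open>shift 1 s\<close> and \<open>shift 2 s\<close>, and none of these moves changes \<open>X 1 s\<close> much.\<close>

lemma second_difference_le:
  assumes s: "s \<le> h"
  defines "W \<equiv> {..7 * h} \<times> {..7 * h}"
  shows "(\<Sum>w\<in>W. \<Sum>i\<le>8 * h - 2 * s. \<bar>\<phi> 1 (i + 2 * s, w) - 2 * \<phi> 1 (i + s, w) + \<phi> 1 (i, w)\<bar>) \<le> 12 * real s * E"
proof -
  define A where "A = W \<times> {..8 * h - 2 * s}"
  define u where "u = (\<lambda>(w, i). (i, w) :: point)"
  define u1 where "u1 a = shift 3 s (u a)" for a
  define u2 where "u2 a = shift 0 s (u a)" for a
  define u3 where "u3 a = shift 2 s (u2 a)" for a
  \<comment> \<open>Direction \<open>3\<close> is the sum of directions \<open>0\<close>,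
    \<open>1\<close> and \<open>2\<close>.\<close>
  have u13: "shift 1 s (u3 a) = u1 a" for a
    by (cases a) (auto simp: u1_def u2_def u3_def u_def shift_def)
  have fin: "finite A" by (simp add: A_def W_def)
  have inj: "inj_on u A" by (auto simp: u_def inj_on_def)
  have inj': "inj_on u1 A" "inj_on u2 A" "inj_on u3 A"
    unfolding u1_def u2_def u3_def by (intro inj_on_shift inj)+
  have main: "shift 1 s (shift 0 s (u3 a)) \<in> B" "shift 2 s (shift 0 s (u2 a)) \<in> B"
      "shift 3 s (shift 0 s (u a)) \<in> B" if "a \<in> A" for a
    using that s by (cases a; auto simp: A_def W_def u2_def u3_def u_def shift_def box_def)+
  have sub: "shift 0 s x \<in> B" "shift z s x \<in> B" "shift 0 s (shift z s x) \<in> B"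
    if "shift z s (shift 0 s x) \<in> B" for z x
    using shift_box[OF that, of 0] shift_box[OF that[unfolded shift_commute[of z s 0 s x]], of 0]
      that[unfolded shift_commute[of z s 0 s x]] by simp_all
  have box1: "shift 3 s (u a) \<in> B" "shift 3 s (u2 a) \<in> B" "shift 0 s (u a) \<in> B" "shift 0 s (u1 a) \<in> B"
      "shift 1 s (u3 a) \<in> B" "shift 1 s (shift 0 s (u3 a)) \<in> B" "shift 0 s (u3 a) \<in> B"
      "shift 2 s (u2 a) \<in> B" "shift 2 s (shift 0 s (u2 a)) \<in> B" "shift 0 s (u2 a) \<in> B"
    if "a \<in> A" for a
    using main[OF that] sub[OF main(1)[OF that]] sub[OF main(2)[OF that]] sub[OF main(3)[OF that]]
    unfolding u13 by (simp_all only: u1_def u2_def u3_def)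
  have "(\<Sum>w\<in>W. \<Sum>i\<le>8 * h - 2 * s. \<bar>\<phi> 1 (i + 2 * s, w) - 2 * \<phi> 1 (i + s, w) + \<phi> 1 (i, w)\<bar>) =
      (\<Sum>a\<in>A. \<bar>X 1 s (u2 a) - X 1 s (u a)\<bar>)"
    unfolding A_def sum.cartesian_product
  proof (intro sum.cong refl, clarify)
    fix i j k
    have "shift 0 s (u2 ((j, k), i)) = (i + 2 * s, j, k)" "u2 ((j, k), i) = (i + s, j, k)"
      "shift 0 s (u ((j, k), i)) = (i + s, j, k)" "u ((j, k), i) = (i, j, k)"
      by (simp_all add: u2_def u_def shift_def)
    then show "\<bar>\<phi> 1 (i + 2 * s, j, k) - 2 * \<phi> 1 (i + s, j, k) + \<phi> 1 (i, j, k)\<bar> =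
        \<bar>X 1 s (u2 ((j, k), i)) - X 1 s (u ((j, k), i))\<bar>"
      by (simp add: X_def)
  qed
  also have "\<dots> \<le> (\<Sum>a\<in>A. (V 3 s (u a) + V 3 s (u2 a) + V 0 s (u a) + V 0 s (u1 a)) +
      (V 1 s (u3 a) + V 1 s (shift 0 s (u3 a)) + V 0 s (u3 a) + V 0 s (u1 a)) +
      (V 2 s (u2 a) + V 2 s (shift 0 s (u2 a)) + V 0 s (u2 a) + V 0 s (u3 a)))"
  proof (rule sum_mono)
    fix a assume a: "a \<in> A"
    show "\<bar>X 1 s (u2 a) - X 1 s (u a)\<bar> \<le> (V 3 s (u a) + V 3 s (u2 a) + V 0 s (u a) + V 0 s (u1 a)) +
      (V 1 s (u3 a) + V 1 s (shift 0 s (u3 a)) + V 0 s (u3 a) + V 0 s (u1 a)) +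
      (V 2 s (u2 a) + V 2 s (shift 0 s (u2 a)) + V 0 s (u2 a) + V 0 s (u3 a))"
      using parallelogram[of 3 s s "u a"] parallelogram[of 1 s s "u3 a"] parallelogram[of 2 s s "u2 a"]
        main[OF a]
      unfolding u13 u1_def[symmetric] u2_def[symmetric] u3_def[symmetric] by simp
  qed
  \<comment> \<open>Three parallelograms with four error terms each give the constant 12.\<close>
  also have "\<dots> \<le> (s * E + s * E + s * E + s * E) + (s * E + s * E + s * E + s * E) + (s * E + s * E + s * E + s * E)"
    unfolding sum.distrib
    by (intro add_mono sum_V_le_mult inj_on_shift fin inj inj' box1) simp_all
  finally show ?thesis by (simp add: algebra_simps)
qed

text \<open>The rise across the box splits at \<open>4 * h\<close> into \<open>M0\<close> and
  \<open>M1\<close>. By rigidity, direction \<open>3\<close> carries them to the planes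
  \<open>t\<close> and \<open>4 * h - t\<close> for all \<open>t < h\<close>, at a cost of
  \<open>4 * E\<close> each; these planes are all distinct. The square \<open>{h..6 * h}\<close>
  leaves room for such shifts inside \<open>{..7 * h}\<close>.\<close>

lemma first_difference_ge:
  assumes pin: "200 * real h ^ 3 - 2 * E \<le> (\<Sum>w\<in>{h..6 * h} \<times> {h..6 * h}. \<phi> 1 (8 * h, w) - \<phi> 1 (0, w))"
    and E: "E \<le> real h ^ 3 / 10 ^ 6"
  shows "4 * real h * (49 * real h ^ 3) \<le>
    shift_sum ({..7 * h} \<times> {..7 * h}) (8 * h) (\<lambda>a b. \<bar>b - a\<bar>) (\<lambda>w i. \<phi> 1 (i, w)) (4 * h)"
proof -
  let ?s = "4 * h" and ?W = "{..7 * h} \<times> {..7 * h}" and ?Q = "{h..6 * h} \<times> {h..6 * h}"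
  define r where "r i = (\<Sum>w\<in>?W. \<bar>X 1 ?s (i, w)\<bar>)" for i
  define M0 where "M0 = (\<Sum>w\<in>?Q. X 1 ?s (0, w))"
  define M1 where "M1 = (\<Sum>w\<in>?Q. X 1 ?s (4 * h, w))"
  have rge: "(\<Sum>w\<in>?Q. \<bar>X 1 ?s (i, p w)\<bar>) \<le> r i" if "inj_on p ?Q" "p ` ?Q \<subseteq> ?W" for i p
  proof -
    have "(\<Sum>w\<in>?Q. \<bar>X 1 ?s (i, p w)\<bar>) = (\<Sum>w\<in>p ` ?Q. \<bar>X 1 ?s (i, w)\<bar>)"
      by (simp only: sum.reindex[OF that(1)] o_def)
    also have "\<dots> \<le> r i" unfolding r_def using that by (intro sum_mono2) auto
    finally show ?thesis .
  qed
  have fwd: "M0 - 4 * E \<le> r t" if t: "t < h" for t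
  proof -
    let ?u = "\<lambda>w. (0::nat, w) :: point"
    have "M0 \<le> (\<Sum>w\<in>?Q. \<bar>X 1 ?s (shift 3 t (?u w))\<bar> +
        (V 3 t (?u w) + V 3 t (shift 0 ?s (?u w)) + V 0 ?s (?u w) + V 0 ?s (shift 3 t (?u w))))"
      unfolding M0_def
    proof (rule sum_mono)
      fix w assume "w \<in> ?Q"
      then have "shift 3 t (shift 0 ?s (?u w)) \<in> B" using t by (auto simp: shift_def box_def)
      from parallelogram[OF insertI2[OF insertI2[OF insertI1]] this]
      show "X 1 ?s (?u w) \<le> \<bar>X 1 ?s (shift 3 t (?u w))\<bar> +
        (V 3 t (?u w) + V 3 t (shift 0 ?s (?u w)) + V 0 ?s (?u w) + V 0 ?s (shift 3 t (?u w)))"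
        by linarith
    qed
    also have "\<dots> \<le> (\<Sum>w\<in>?Q. \<bar>X 1 ?s (shift 3 t (?u w))\<bar>) + (E + E + E + E)"
      unfolding sum.distrib using t
      by (intro add_mono sum_V_le order_refl) (auto simp: inj_on_def shift_def box_def)
    also have "(\<Sum>w\<in>?Q. \<bar>X 1 ?s (shift 3 t (?u w))\<bar>) = (\<Sum>w\<in>?Q. \<bar>X 1 ?s (t, (case w of (j, k) \<Rightarrow> (j + t, k + t)))\<bar>)"
      by (intro sum.cong) (auto simp: shift_def)
    also have "\<dots> \<le> r t" using t by (intro rge) (auto simp: inj_on_def)
    finally show ?thesis by simp
  qed
  have bwd: "M1 - 4 * E \<le> r (4 * h - t)" if t: "t < h" for t
  proof -
    let ?u = "\<lambda>(j, k). (4 * h - t, j - t, k - t) :: point"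
    have up: "shift 3 t (?u w) = (4 * h, w)" if "w \<in> ?Q" for w
      using that t by (auto simp: shift_def)
    have "M1 \<le> (\<Sum>w\<in>?Q. \<bar>X 1 ?s (?u w)\<bar> +
        (V 3 t (?u w) + V 3 t (shift 0 ?s (?u w)) + V 0 ?s (?u w) + V 0 ?s (shift 3 t (?u w))))"
      unfolding M1_def
    proof (rule sum_mono)
      fix w assume w: "w \<in> ?Q"
      then have "shift 3 t (shift 0 ?s (?u w)) \<in> B" using t by (auto simp: shift_def box_def)
      from parallelogram[OF insertI2[OF insertI2[OF insertI1]] this]
      show "X 1 ?s (4 * h, w) \<le> \<bar>X 1 ?s (?u w)\<bar> +
        (V 3 t (?u w) + V 3 t (shift 0 ?s (?u w)) + V 0 ?s (?u w) + V 0 ?s (shift 3 t (?u w)))"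
        unfolding up[OF w] by linarith
    qed
    also have "\<dots> \<le> (\<Sum>w\<in>?Q. \<bar>X 1 ?s (?u w)\<bar>) + (E + E + E + E)"
      unfolding sum.distrib using t
      by (intro add_mono sum_V_le order_refl) (auto simp: inj_on_def shift_def box_def)
    also have "(\<Sum>w\<in>?Q. \<bar>X 1 ?s (?u w)\<bar>) = (\<Sum>w\<in>?Q. \<bar>X 1 ?s (4 * h - t, (case w of (j, k) \<Rightarrow> (j - t, k - t)))\<bar>)"
      by (intro sum.cong) auto
    also have "\<dots> \<le> r (4 * h - t)" using t by (intro rge) (auto simp: inj_on_def)
    finally show ?thesis by simp
  qed
  have r0: "0 \<le> r i" for i by (simp add: r_def sum_nonneg)
  have "M0 + M1 = (\<Sum>w\<in>?Q. \<phi> 1 (8 * h, w) - \<phi> 1 (0, w))"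
    unfolding M0_def M1_def sum.distrib[symmetric]
    by (intro sum.cong) (auto simp: X_def shift_def)
  moreover have "E * 1000000 \<le> real h ^ 3" "0 \<le> real h ^ 3" using E by simp_all
  ultimately have "196 * real h ^ 3 \<le> M0 + M1 - 8 * E" using pin by linarith
  then have "real h * (196 * real h ^ 3) \<le> real h * (M0 + M1 - 8 * E)" by (intro mult_left_mono) auto
  also have "\<dots> = (\<Sum>t<h. (M0 - 4 * E) + (M1 - 4 * E))" by simp
  also have "\<dots> \<le> (\<Sum>t<h. r t) + (\<Sum>t<h. r (4 * h - t))"
    unfolding sum.distrib using fwd bwd by (intro add_mono sum_mono) auto
  also have "(\<Sum>t<h. r (4 * h - t)) = (\<Sum>i\<in>(\<lambda>t. 4 * h - t) ` {..<h}. r i)"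
    by (subst sum.reindex) (auto simp: inj_on_def)
  also have "(\<Sum>t<h. r t) + \<dots> = (\<Sum>i\<in>{..<h} \<union> (\<lambda>t. 4 * h - t) ` {..<h}. r i)"
    by (rule sum.union_disjoint[symmetric]) auto
  also have "\<dots> \<le> (\<Sum>i\<le>4 * h. r i)" using r0 by (intro sum_mono2) auto
  also have "\<dots> = (\<Sum>w\<in>?W. \<Sum>i\<le>4 * h. \<bar>X 1 ?s (i, w)\<bar>)" unfolding r_def by (rule sum.swap)
  also have "\<dots> = shift_sum ?W (8 * h) (\<lambda>a b. \<bar>b - a\<bar>) (\<lambda>w i. \<phi> 1 (i, w)) (4 * h)"
    unfolding shift_sum_def by (intro sum.cong refl) (auto simp: X_def shift_def)
  finally show ?thesis by simp
qed

text \<open>The staircase lemma is applied to the lines in direction \<open>0\<close>, with top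
  scale \<open>2 ^ (\<kappa> + 2) = 4 * h\<close>. There are at most \<open>64 * h ^ 2\<close> lines
  and the range is \<open>64 * h\<close>, so \<open>\<delta> = 1 / (8192 * N)\<close> makes the loss
  from adjacent jumps at most \<open>h ^ 3\<close>.\<close>

lemma few_values_impossible:
  assumes h: "h = 2 ^ \<kappa>" and N: "0 < N" "(1 - 1 / (8192 * real N)) ^ \<kappa> * real N < 1 / 100"
    and pin: "200 * real h ^ 3 - 2 * E \<le> (\<Sum>w\<in>{h..6 * h} \<times> {h..6 * h}. \<phi> 1 (8 * h, w) - \<phi> 1 (0, w))"
    and E: "E \<le> real h ^ 3 / 10 ^ 6"
    and range: "\<And>u. u \<in> B \<Longrightarrow> 0 \<le> \<phi> 1 u \<and> \<phi> 1 u \<le> 64 * real h"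
    and few: "card (\<phi> 1 ` B) \<le> N"
  shows False
proof -
  let ?W = "{..7 * h} \<times> {..7 * h}" and ?\<delta> = "1 / (8192 * real N)"
  have h0: "1 \<le> real h" using h by simp
  have N1: "1 \<le> real N" using N by simp
  have inB: "(i, w) \<in> B" if "w \<in> ?W" "i \<le> 8 * h" for i w
    using that by (auto simp: box_def)
  have inL: "(i, w) \<in> lat (8 * h) 0" if "w \<in> ?W" "i < 8 * h" for i w
    using that by (auto simp: box_def lat_def shift_def)
  have cW: "real (card ?W) \<le> 64 * real h ^ 2"
  proof -
    have "real (card ?W) = (7 * real h + 1) ^ 2" by (simp add: power2_eq_square algebra_simps)
    also have "\<dots> \<le> (8 * real h) ^ 2" using h0 by (intro power_mono) auto
    finally show ?thesis by (simp add: power_mult_distrib)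
  qed
  have CW: "real N * real (card ?W) * (64 * real h) \<le> 4096 * real N * real h ^ 3"
  proof -
    have "real N * real (card ?W) * (64 * real h) \<le> real N * (64 * real h ^ 2) * (64 * real h)"
      using cW by (intro mult_right_mono mult_left_mono) auto
    then show ?thesis by (simp add: power2_eq_square power3_eq_cube)
  qed
  have h3: "0 < real h ^ 3" using h0 by simp
  have E': "E * 1000000 \<le> real h ^ 3" using E by simp
  show False
  proof (rule few_values_second_differences[where W = ?W and m = "8 * h" and f = "\<lambda>w i. \<phi> 1 (i, w)"
        and \<nu> = "\<lambda>w i. v 0 (i, w)" and E = E and C = "64 * real h" and N = N and \<kappa> = \<kappa>
        and \<tau> = "49 * real h ^ 3" and \<delta> = ?\<delta>])
    show "(\<Sum>w\<in>?W. \<Sum>i\<le>8 * h - 2 * s. \<bar>\<phi> 1 (i + 2 * s, w) - 2 * \<phi> 1 (i + s, w) + \<phi> 1 (i, w)\<bar>) \<le> 12 * real s * E"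
      if "s \<le> 2 ^ \<kappa>" for s using second_difference_le that h by simp
    show "\<phi> 1 (i, w) - v 0 (i, w) \<le> \<phi> 1 (Suc i, w)" if "w \<in> ?W" "i < 8 * h" for w i
    proof -
      have "shift 0 1 (i, w) = (Suc i, w)" by (cases w) (simp add: shift_def)
      then show ?thesis
        using slack_le_v[of 0 1 "(i, w)"] lip[of 0 1 "(i, w)"] inL[OF that] by (simp add: slack_def sg_def)
    qed
    show "0 \<le> v 0 (i, w)" if "w \<in> ?W" "i < 8 * h" for w i using inL[OF that] by (simp add: v_nonneg)
    show "(\<Sum>w\<in>?W. \<Sum>i<8 * h. v 0 (i, w)) \<le> E"
    proof -
      have "shift 0 i (0, w) = (i, w)" for i w by (cases w) (simp add: shift_def)
      then have "(\<Sum>w\<in>?W. \<Sum>i<8 * h. v 0 (i, w)) = (\<Sum>w\<in>?W. V 0 (8 * h) (0, w))" by (simp add: V_def)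
      also have "\<dots> \<le> E" by (rule sum_V_le) (auto simp: inj_on_def shift_def box_def)
      finally show ?thesis .
    qed
    show "0 \<le> \<phi> 1 (i, w) \<and> \<phi> 1 (i, w) \<le> 64 * real h" if "w \<in> ?W" "i \<le> 8 * h" for w i
      using range inB[OF that] by simp
    show "card ((\<lambda>i. \<phi> 1 (i, w)) ` {..8 * h}) \<le> N" if "w \<in> ?W" for w
    proof -
      have "(\<lambda>i. \<phi> 1 (i, w)) ` {..8 * h} \<subseteq> \<phi> 1 ` B" using inB[OF that] by auto
      then show ?thesis using few card_mono[of "\<phi> 1 ` B"] by (meson finite_box finite_imageI le_trans)
    qed
    show "2 ^ (\<kappa> + 2) \<le> 8 * h" using h by simp
    show "2 ^ (\<kappa> + 2) * (49 * real h ^ 3) \<le>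
        shift_sum ?W (8 * h) (\<lambda>a b. \<bar>b - a\<bar>) (\<lambda>w i. \<phi> 1 (i, w)) (2 ^ (\<kappa> + 2))"
      using first_difference_ge[OF pin E] h by (simp add: mult.commute)
    show "18 * E + 2 * ?\<delta> * (64 * real h) * real N * real (card ?W) < 49 * real h ^ 3"
    proof -
      have "2 * ?\<delta> * (64 * real h) * real N * real (card ?W) = 2 * ?\<delta> * (real N * real (card ?W) * (64 * real h))"
        by simp
      also have "\<dots> \<le> 2 * ?\<delta> * (4096 * real N * real h ^ 3)" using CW by (intro mult_left_mono) auto
      also have "\<dots> = real h ^ 3" using N1 by simp
      finally show ?thesis using E' h3 by linarith
    qed
    show "(1 - ?\<delta>) ^ \<kappa> * real N * real (card ?W) * (64 * real h) < 49 * real h ^ 3 - 2 * E"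
    proof -
      have "(1 - ?\<delta>) ^ \<kappa> * real N * real (card ?W) * (64 * real h) =
          (1 - ?\<delta>) ^ \<kappa> * (real N * real (card ?W) * (64 * real h))" by simp
      also have "\<dots> \<le> (1 - ?\<delta>) ^ \<kappa> * (4096 * real N * real h ^ 3)"
        using CW N1 by (intro mult_left_mono) auto
      also have "\<dots> = ((1 - ?\<delta>) ^ \<kappa> * real N) * (4096 * real h ^ 3)" by simp
      also have "\<dots> \<le> 1 / 100 * (4096 * real h ^ 3)" using N(2) by (intro mult_right_mono) auto
      also have "\<dots> < 49 * real h ^ 3 - 2 * E" using E' h3 by linarith
      finally show ?thesis .
    qed
  qed (use N1 in auto)
qed

end

section \<open>The graph\<close>

definition line_start :: "nat \<Rightarrow> nat \<Rightarrow> point set" where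
  "line_start m z = {u \<in> box m. u \<notin> shift z 1 ` box m}"

definition line_end :: "nat \<Rightarrow> nat \<Rightarrow> point set" where
  "line_end m z = {u \<in> box m. shift z 1 u \<notin> box m}"

definition face :: "nat \<Rightarrow> nat \<Rightarrow> point set" where
  "face m i = {i} \<times> {..m} \<times> {..m}"

lemma finite_line [simp]: "finite (line_start m z)" "finite (line_end m z)" "finite (face m i)"
  by (simp_all add: line_start_def line_end_def face_def)

text \<open>Heads of lattice edges are all points except line starts, and tails are all points
  except line ends.\<close>

lemma sum_lattice_telescope:
  fixes f :: "point \<Rightarrow> real"
  shows "(\<Sum>u\<in>lat m z. f (shift z 1 u) - f u) = (\<Sum>u\<in>line_end m z. f u) - (\<Sum>u\<in>line_start m z. f u)"
proof -
  have "(\<Sum>u\<in>lat m z. f (shift z 1 u)) = (\<Sum>u\<in>shift z 1 ` lat m z. f u)"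
    using inj_on_subset[OF inj_shift subset_UNIV] by (subst sum.reindex) (auto simp: o_def)
  also have "shift z 1 ` lat m z = box m - line_start m z"
    by (auto simp: lat_def line_start_def)
  also have "(\<Sum>u\<in>\<dots>. f u) = (\<Sum>u\<in>box m. f u) - (\<Sum>u\<in>line_start m z. f u)"
    by (rule sum_diff) (auto simp: line_start_def)
  finally have 1: "(\<Sum>u\<in>lat m z. f (shift z 1 u)) = \<dots>" .
  have "lat m z = box m - line_end m z" by (auto simp: lat_def line_end_def)
  then have 2: "(\<Sum>u\<in>lat m z. f u) = (\<Sum>u\<in>box m. f u) - (\<Sum>u\<in>line_end m z. f u)"
    by (simp only:) (rule sum_diff, auto simp: line_end_def)
  show ?thesis unfolding sum_subtractf 1 2 by simp
qed

lemma card_line_start: "card (line_start m z) = card (line_end m z)"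
  using sum_lattice_telescope[of "\<lambda>_. 1" z m] by simp

lemma card_line_end_le:
  assumes "z < 4"
  shows "card (line_end m z) \<le> 3 * (m + 1)\<^sup>2"
proof -
  have "line_end m z \<subseteq> ({m} \<times> {..m} \<times> {..m}) \<union> ({..m} \<times> {m} \<times> {..m}) \<union> ({..m} \<times> {..m} \<times> {m})"
    by (auto simp: line_end_def box_def shift_def split: if_splits)
  then have "card (line_end m z) \<le> card (({m} \<times> {..m} \<times> {..m}) \<union> ({..m} \<times> {m} \<times> {..m}) \<union> ({..m} \<times> {..m} \<times> {m}))"
    by (intro card_mono) auto
  also have "\<dots> \<le> card ({m} \<times> {..m} \<times> {..m}) + card ({..m} \<times> {m} \<times> {..m}) + card ({..m} \<times> {..m} \<times> {m})"
    by (meson card_Un_le add_mono le_trans order_refl)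
  finally show ?thesis by (simp add: card_cartesian_product power2_eq_square)
qed

text \<open>The terminals are \<open>s\<^sub>c = c\<close> and \<open>t\<^sub>c = 3 + c\<close> for \<open>c < 3\<close>.\<close>

definition vx :: "point \<Rightarrow> nat" where
  "vx = (\<lambda>(i, j, k). 6 + prod_encode (i, prod_encode (j, k)))"

definition unvx :: "nat \<Rightarrow> point" where
  "unvx x = (let (i, y) = prod_decode (x - 6) in (i, prod_decode y))"

text \<open>Sorting gives one name to each unordered pair, so parallel edges are merged.\<close>

definition edge_code :: "nat \<Rightarrow> nat \<Rightarrow> nat" where
  "edge_code x y = prod_encode (min x y, max x y)"

definition edge_ends :: "nat \<Rightarrow> nat set" where
  "edge_ends e = (case prod_decode e of (x, y) \<Rightarrow> {x, y})"

text \<open>The summands are lattice edges, links to the starts and to the ends of lattice lines,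
  links of \<open>s\<^sub>1\<close>, \<open>s\<^sub>2\<close> to the face \<open>0\<close>, and
  links of \<open>t\<^sub>1\<close>, \<open>t\<^sub>2\<close> to the face \<open>m\<close>. The
  first three kinds occur once for each direction \<open>z\<close> and commodity
  \<open>c\<close>.\<close>

type_synonym step =
  "nat \<times> nat \<times> point + nat \<times> nat \<times> point + nat \<times> nat \<times> point + nat \<times> point + nat \<times> point"

definition lines :: "(nat \<Rightarrow> point set) \<Rightarrow> (nat \<times> nat \<times> point) set" where
  "lines P = (SIGMA z:{..<4}. SIGMA c:{..<3}. P z)"

definition steps :: "nat \<Rightarrow> step set" where
  "steps m = lines (lat m) <+> lines (line_start m) <+> lines (line_end m) <+>
     ({1, 2} \<times> face m 0) <+> ({1, 2} \<times> face m m)"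

text \<open>Commodity \<open>c\<close> runs along all lattice lines in direction of increasing \<open>base_pot c\<close>, which is
  against direction \<open>z\<close> if \<open>z = c\<close>.\<close>

fun step_ends :: "step \<Rightarrow> nat \<times> nat" where
  "step_ends (Inl (z, c, u)) = (vx u, vx (shift z 1 u))"
| "step_ends (Inr (Inl (z, c, u))) = (if z = c then 3 + c else c, vx u)"
| "step_ends (Inr (Inr (Inl (z, c, u)))) = (if z = c then c else 3 + c, vx u)"
| "step_ends (Inr (Inr (Inr (Inl (c, u))))) = (c, vx u)"
| "step_ends (Inr (Inr (Inr (Inr (c, u))))) = (3 + c, vx u)"

definition step_edge :: "step \<Rightarrow> nat" where
  "step_edge x = (case step_ends x of (a, b) \<Rightarrow> edge_code a b)"

text \<open>Steps with equal ends form one edge whose capacity counts them. The graph is thus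
  simple, and volumes are plain sums over steps.\<close>

definition hard_graph :: "nat \<Rightarrow> (nat, nat) cap_graph" where
  "hard_graph m = \<lparr>verts = {..<6} \<union> vx ` box m, edges = step_edge ` steps m, ends = edge_ends,
     cap = (\<lambda>e. real (card {x \<in> steps m. step_edge x = e}))\<rparr>"

lemma unvx_vx [simp]: "unvx (vx u) = u"
  by (cases u) (simp add: unvx_def vx_def)

lemma vx_ge [simp]: "6 \<le> vx u"
  by (cases u) (simp add: vx_def)

lemma vx_not_less [simp]: "k \<le> 6 \<Longrightarrow> \<not> vx u < k"
  using vx_ge[of u] by linarith

lemma vx_neq [simp]: "c < 6 \<Longrightarrow> vx u \<noteq> c" "c < 6 \<Longrightarrow> c \<noteq> vx u"
  using vx_ge[of u] by linarith+

lemma vx_eq_iff [simp]: "vx u = vx w \<longleftrightarrow> u = w"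
  by (metis unvx_vx)

lemma edge_ends_code [simp]: "edge_ends (edge_code x y) = {x, y}"
  by (auto simp: edge_ends_def edge_code_def min_def max_def)

lemma edge_code_eq: "{x, y} = {x', y'} \<Longrightarrow> edge_code x y = edge_code x' y'"
  by (auto simp: edge_code_def doubleton_eq_iff min.commute max.commute)

lemma finite_lines: "(\<And>z. finite (P z)) \<Longrightarrow> finite (lines P)"
  by (auto simp: lines_def)

lemma finite_steps: "finite (steps m)"
  unfolding steps_def by (intro finite_Plus finite_lines finite_cartesian_product) auto

lemma sum_lines: "(\<Sum>x\<in>lines P. F x) = (\<Sum>z<4. \<Sum>c<3. \<Sum>u\<in>P z. F (z, c, u))"
  if "\<And>z. finite (P z)" for F :: "_ \<Rightarrow> real"
  unfolding lines_def using that by (simp add: sum.Sigma split_def)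

lemma shift_1_neq: "z < 4 \<Longrightarrow> shift z 1 u \<noteq> u"
  by (cases u) (auto simp: shift_def)

lemma step_ends_cases:
  assumes "x \<in> steps m" "step_ends x = (a, b)"
  shows "a \<noteq> b" "a \<in> {..<6} \<union> vx ` box m" "b \<in> {..<6} \<union> vx ` box m"
proof -
  have "a \<noteq> b \<and> a \<in> {..<6} \<union> vx ` box m \<and> b \<in> {..<6} \<union> vx ` box m"
    using assms shift_1_neq
    by (cases x rule: step_ends.cases)
      (auto simp: steps_def lines_def lat_def line_start_def line_end_def face_def box_def
        split: if_splits)
  then show "a \<noteq> b" "a \<in> {..<6} \<union> vx ` box m" "b \<in> {..<6} \<union> vx ` box m" by auto
qed

lemma hard_graph_simple: "cap_simple_graph (hard_graph m)"
proof -
  have fin: "finite (steps m)" by (rule finite_steps)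
  have ex: "\<exists>a b. e = edge_code a b \<and> a \<noteq> b \<and> a \<in> {..<6} \<union> vx ` box m \<and> b \<in> {..<6} \<union> vx ` box m"
    if "e \<in> step_edge ` steps m" for e
  proof -
    obtain x where x: "x \<in> steps m" "e = step_edge x" using \<open>e \<in> _\<close> by auto
    obtain a b where ab: "step_ends x = (a, b)" by fastforce
    show ?thesis using step_ends_cases[OF x(1) ab] x(2) ab by (auto simp: step_edge_def)
  qed
  have "inj_on edge_ends (step_edge ` steps m)"
  proof (rule inj_onI)
    fix e e' assume "e \<in> step_edge ` steps m" "e' \<in> step_edge ` steps m" "edge_ends e = edge_ends e'"
    then show "e = e'" using ex[of e] ex[of e'] edge_code_eq by (metis edge_ends_code)
  qed
  moreover have "edge_ends e \<subseteq> {..<6} \<union> vx ` box m \<and> card (edge_ends e) = 2" if "e \<in> step_edge ` steps m" for e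
    using ex[OF that] by auto
  moreover have "0 < card {x \<in> steps m. step_edge x = e}" if "e \<in> step_edge ` steps m" for e
    using that fin by (auto simp: card_gt_0_iff)
  ultimately show ?thesis
    using fin by (simp add: cap_simple_graph_def cap_multigraph_def hard_graph_def)
qed

lemma sum_cap_hard_graph:
  "(\<Sum>e\<in>edges (hard_graph m). cap (hard_graph m) e * F e) = (\<Sum>x\<in>steps m. F (step_edge x))"
proof -
  have "(\<Sum>x\<in>steps m. F (step_edge x)) = (\<Sum>e\<in>step_edge ` steps m. \<Sum>x\<in>{x\<in>steps m. step_edge x = e}. F (step_edge x))"
    by (rule sum.image_gen[OF finite_steps])
  also have "\<dots> = (\<Sum>e\<in>step_edge ` steps m. real (card {x\<in>steps m. step_edge x = e}) * F e)"
    by (intro sum.cong refl) simp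
  finally show ?thesis by (simp add: hard_graph_def)
qed

text \<open>Both for the original and for a contracted graph, the following identity splits the volume
  into the part that every metric has to pay and a sum of nonnegative slacks.\<close>

lemma volume_split:
  fixes F :: "nat \<Rightarrow> real" and \<psi> :: "nat \<Rightarrow> point \<Rightarrow> real" and D D1 D2 :: real
  shows "(\<Sum>x\<in>steps m. F (step_edge x)) =
    (\<Sum>z<4. \<Sum>c<3::nat. D * real (card (line_end m z))) + (D1 + D2) * real ((m + 1)\<^sup>2) +
    (\<Sum>z<4. \<Sum>c<3. \<Sum>u\<in>lat m z. F (edge_code (vx u) (vx (shift z 1 u))) - sg z c * (\<psi> c (shift z 1 u) - \<psi> c u)) +
    (\<Sum>z<4. \<Sum>c<3. \<Sum>u\<in>line_start m z. F (edge_code (if z = c then 3 + c else c) (vx u)) - (if z = c then D - \<psi> c u else \<psi> c u)) +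
    (\<Sum>z<4. \<Sum>c<3. \<Sum>u\<in>line_end m z. F (edge_code (if z = c then c else 3 + c) (vx u)) - (if z = c then \<psi> c u else D - \<psi> c u)) +
    (\<Sum>u\<in>face m 0. F (edge_code 1 (vx u)) + F (edge_code 2 (vx u)) - D1) +
    (\<Sum>u\<in>face m m. F (edge_code 4 (vx u)) + F (edge_code 5 (vx u)) - D2)"
proof -
  let ?l = "\<lambda>z (c::nat) u. F (edge_code (vx u) (vx (shift z 1 u)))"
  let ?a = "\<lambda>z c u. F (edge_code (if z = c then 3 + c else c) (vx u))"
  let ?b = "\<lambda>z c u. F (edge_code (if z = c then c else 3 + c) (vx u))"
  \<comment> \<open>The potential terms of the lattice edges telescope against those at the two
    ends, which leaves \<open>D\<close> for each line.\<close>
  have line: "(\<Sum>u\<in>lat m z. ?l z c u) + (\<Sum>u\<in>line_start m z. ?a z c u) + (\<Sum>u\<in>line_end m z. ?b z c u) =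
      D * real (card (line_end m z)) + (\<Sum>u\<in>lat m z. ?l z c u - sg z c * (\<psi> c (shift z 1 u) - \<psi> c u)) +
      (\<Sum>u\<in>line_start m z. ?a z c u - (if z = c then D - \<psi> c u else \<psi> c u)) +
      (\<Sum>u\<in>line_end m z. ?b z c u - (if z = c then \<psi> c u else D - \<psi> c u))" for z c
  proof -
    have "(\<Sum>u\<in>lat m z. sg z c * (\<psi> c (shift z 1 u) - \<psi> c u)) =
        sg z c * ((\<Sum>u\<in>line_end m z. \<psi> c u) - (\<Sum>u\<in>line_start m z. \<psi> c u))"
      by (simp only: sum_distrib_left[symmetric] sum_lattice_telescope)
    then show ?thesis
      by (cases "z = c") (simp_all add: sum_subtractf sg_def card_line_start)
  qed
  have face: "(\<Sum>u\<in>face m i. G u - r) = (\<Sum>u\<in>face m i. G u) - r * real ((m + 1)\<^sup>2)" for i r and G :: "_ \<Rightarrow> real"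
    by (simp add: sum_subtractf face_def card_cartesian_product power2_eq_square)
  have "(\<Sum>x\<in>steps m. F (step_edge x)) =
      (\<Sum>z<4. \<Sum>c<3. \<Sum>u\<in>lat m z. ?l z c u) + ((\<Sum>z<4. \<Sum>c<3. \<Sum>u\<in>line_start m z. ?a z c u) +
      ((\<Sum>z<4. \<Sum>c<3. \<Sum>u\<in>line_end m z. ?b z c u) +
      ((\<Sum>u\<in>face m 0. F (edge_code 1 (vx u)) + F (edge_code 2 (vx u))) +
       (\<Sum>u\<in>face m m. F (edge_code 4 (vx u)) + F (edge_code 5 (vx u))))))"
    unfolding steps_def
    by (simp add: sum.Plus finite_lines sum_lines step_edge_def sum.cartesian_product'
        sum.distrib del: One_nat_def)
  also have "\<dots> = (\<Sum>z<4. \<Sum>c<3. (\<Sum>u\<in>lat m z. ?l z c u) + (\<Sum>u\<in>line_start m z. ?a z c u) + (\<Sum>u\<in>line_end m z. ?b z c u)) +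
      ((\<Sum>u\<in>face m 0. F (edge_code 1 (vx u)) + F (edge_code 2 (vx u))) +
       (\<Sum>u\<in>face m m. F (edge_code 4 (vx u)) + F (edge_code 5 (vx u))))"
    by (simp only: sum.distrib add.assoc)
  finally show ?thesis unfolding line face sum.distrib distrib_right by linarith
qed

section \<open>A metric of small volume on the lattice graph\<close>

definition base_pot :: "nat \<Rightarrow> point \<Rightarrow> real" where
  "base_pot c = (\<lambda>(i, j, k). real i + real j + real k - 2 * real (if c = 0 then i else if c = 1 then j else k))"

text \<open>Potential \<open>a < 3\<close> witnesses the distance of \<open>s\<^sub>a\<close> and \<open>t\<^sub>a\<close>, potential \<open>3\<close> that of \<open>s\<^sub>1\<close> and \<open>s\<^sub>2\<close>,
  and potential \<open>4\<close> that of \<open>t\<^sub>1\<close> and \<open>t\<^sub>2\<close>. Edge lengths are the least ones for which all five are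
  1-Lipschitz.\<close>

definition pot :: "nat \<Rightarrow> nat \<Rightarrow> nat \<Rightarrow> real" where
  "pot h a x =
    (if x < 6 then
       if a < 3 then (if x = a then - 32 * real h else if x = 3 + a then 32 * real h else 0)
       else if a = 3 then (if x = 1 then - 32 * real h else if x = 2 then 32 * real h else 0)
       else (if x = 4 then - 16 * real h else if x = 5 then 32 * real h else 0)
     else if a < 3 then base_pot a (unvx x) else if a = 3 then - base_pot 2 (unvx x) else base_pot 2 (unvx x))"

definition edge_len :: "nat \<Rightarrow> nat \<Rightarrow> real" where
  "edge_len h e = (case prod_decode e of (x, y) \<Rightarrow> Max (insert 1 ((\<lambda>a. \<bar>pot h a x - pot h a y\<bar>) ` {..<5})))"

text \<open>The values for \<open>{1, 2}\<close> and \<open>{4, 5}\<close> are the lengths of paths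
  through the faces: summed over \<open>c = 1, 2\<close>, \<open>32 * h + base_pot c u\<close> is
  \<open>64 * h\<close> where \<open>fst u = 0\<close>, and \<open>32 * h - base_pot c u\<close> is
  \<open>48 * h\<close> where \<open>fst u = 8 * h\<close>.\<close>

definition target :: "nat \<Rightarrow> nat set \<Rightarrow> real" where
  "target h P = (if P \<in> {{0, 3}, {1, 4}, {2, 5}, {1, 2}} then 64 * real h
     else if P = {4, 5} then 48 * real h else 0)"

text \<open>The cost that no metric dominating \<open>target\<close> avoids: one distance from
  \<open>s\<^sub>c\<close> to \<open>t\<^sub>c\<close> per commodity and line, and one face distance
  per face point.\<close>

definition base_volume :: "nat \<Rightarrow> real" where
  "base_volume h = (\<Sum>z<4. \<Sum>c<3::nat. 64 * real h * real (card (line_end (8 * h) z))) +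
     (64 * real h + 48 * real h) * real ((8 * h + 1)\<^sup>2)"

lemma edge_len_code:
  "edge_len h (edge_code x y) = Max (insert 1 ((\<lambda>a. \<bar>pot h a x - pot h a y\<bar>) ` {..<5}))"
  by (cases "x \<le> y") (simp_all add: edge_len_def edge_code_def min_def max_def abs_minus_commute)

lemma edge_len_le:
  "1 \<le> r \<Longrightarrow> (\<And>a. a < 5 \<Longrightarrow> \<bar>pot h a x - pot h a y\<bar> \<le> r) \<Longrightarrow> edge_len h (edge_code x y) \<le> r"
  unfolding edge_len_code by (subst Max_le_iff) auto

lemma edge_len_ge_1: "1 \<le> edge_len h e"
  unfolding edge_len_def by (auto intro!: Max_ge split: prod.splits)

lemma pot_lipschitz:
  assumes "a < 5" "edge_ends e = {x, y}"
  shows "\<bar>pot h a y - pot h a x\<bar> \<le> edge_len h e"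
proof -
  obtain x' y' where e: "prod_decode e = (x', y')" by fastforce
  have "\<bar>pot h a x' - pot h a y'\<bar> \<le> edge_len h e"
    unfolding edge_len_def e using assms(1) by (auto intro!: Max_ge)
  moreover have "{x', y'} = {x, y}" using assms(2) by (simp add: edge_ends_def e)
  ultimately show ?thesis by (auto simp: doubleton_eq_iff abs_minus_commute)
qed

lemma base_pot_range:
  assumes "u \<in> box m"
  shows "- real m \<le> base_pot c u" "base_pot c u \<le> 2 * real m"
  using assms by (auto simp: base_pot_def box_def)

lemma base_pot_shift:
  assumes "z < 4" "c < 3"
  shows "base_pot c (shift z 1 u) - base_pot c u = sg z c"
proof -
  have "z \<in> {0, 1, 2, 3}" "c \<in> {0, 1, 2}" using assms by auto
  then show ?thesis by (cases u) (auto simp: base_pot_def shift_def sg_def)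
qed

text \<open>\<open>base_pot c\<close> is coordinate \<open>c\<close> in space, so coordinates 1 and
  2 have a constant sum on each face.\<close>

lemma base_pot_1_2: "base_pot 1 u + base_pot 2 u = 2 * real (fst u)"
  by (cases u) (simp add: base_pot_def)

lemma nat_less_5: "a < 5 \<Longrightarrow> a = 0 \<or> a = 1 \<or> a = 2 \<or> a = 3 \<or> a = (4::nat)" by auto

lemma nat_less_3: "c < 3 \<Longrightarrow> c = 0 \<or> c = 1 \<or> c = (2::nat)" by auto

lemma edge_len_lattice:
  assumes "z < 4"
  shows "edge_len h (edge_code (vx u) (vx (shift z 1 u))) \<le> 1"
proof (rule edge_len_le)
  fix a :: nat
  have "\<bar>base_pot c u - base_pot c (shift z 1 u)\<bar> = 1" if "c < 3" for c
    using base_pot_shift[OF assms that, of u] by (auto simp: sg_def split: if_splits)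
  from this[of a] this[of 2] show "\<bar>pot h a (vx u) - pot h a (vx (shift z 1 u))\<bar> \<le> 1"
    by (auto simp: pot_def)
qed simp

text \<open>Potential \<open>c\<close> gives the bound itself, and for most others the ranges
  suffice. Potential 3 at terminal 1 needs
  \<open>base_pot 1 u + base_pot 2 u \<ge> 0\<close>.\<close>

lemma edge_len_source:
  assumes "u \<in> box (8 * h)" "c < 3" "0 < h"
  shows "edge_len h (edge_code c (vx u)) \<le> 32 * real h + base_pot c u"
proof (rule edge_len_le)
  have b: "- (8 * real h) \<le> base_pot a u" "base_pot a u \<le> 16 * real h" for a
    using base_pot_range[OF assms(1), of a] by simp_all
  show "1 \<le> 32 * real h + base_pot c u" using b[of c] assms(3) by simp
  fix a :: nat assume a: "a < 5"
  show "\<bar>pot h a c - pot h a (vx u)\<bar> \<le> 32 * real h + base_pot c u"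
    using nat_less_5[OF a] nat_less_3[OF assms(2)] b[of 0] b[of 1] b[of 2] base_pot_1_2[of u]
    by (elim disjE) (simp_all add: pot_def)
qed

text \<open>The delicate case is potential 4 at terminal 4. Its value \<open>- 16 * h\<close> there
  fits because \<open>base_pot 1 u + base_pot 2 u \<le> 16 * h\<close>.\<close>

lemma edge_len_sink:
  assumes "u \<in> box (8 * h)" "c < 3" "0 < h"
  shows "edge_len h (edge_code (3 + c) (vx u)) \<le> 32 * real h - base_pot c u"
proof (rule edge_len_le)
  have b: "- (8 * real h) \<le> base_pot a u" "base_pot a u \<le> 16 * real h" for a
    using base_pot_range[OF assms(1), of a] by simp_all
  have "fst u \<le> 8 * h" using assms(1) by (auto simp: box_def)
  then have i: "real (fst u) \<le> 8 * real h" by simp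
  show "1 \<le> 32 * real h - base_pot c u" using b[of c] assms(3) by simp
  fix a :: nat assume a: "a < 5"
  show "\<bar>pot h a (3 + c) - pot h a (vx u)\<bar> \<le> 32 * real h - base_pot c u"
    using nat_less_5[OF a] nat_less_3[OF assms(2)] b[of 0] b[of 1] b[of 2] base_pot_1_2[of u] i
    by (elim disjE) (simp_all add: pot_def)
qed

text \<open>With \<open>32 * h + base_pot c u\<close> as \<open>\<psi> c u\<close>, every remainder
  in \<open>volume_split\<close> is at most zero.\<close>

lemma volume_le_base_volume:
  assumes h: "0 < h"
  shows "(\<Sum>x\<in>steps (8 * h). edge_len h (step_edge x)) \<le> base_volume h"
proof -
  let ?m = "8 * h" and ?\<psi> = "\<lambda>c u. 32 * real h + base_pot c u"
  have lat: "edge_len h (edge_code (vx u) (vx (shift z 1 u))) - sg z c * (?\<psi> c (shift z 1 u) - ?\<psi> c u) \<le> 0"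
    if "z < 4" "c < 3" for z c u
    using edge_len_lattice[OF that(1), of h u] base_pot_shift[OF that, of u] by (cases "z = c") (simp_all add: sg_def)
  have in_box: "u \<in> line_start ?m z \<Longrightarrow> u \<in> box ?m" "u \<in> line_end ?m z \<Longrightarrow> u \<in> box ?m"
    "u \<in> face ?m 0 \<Longrightarrow> u \<in> box ?m" "u \<in> face ?m ?m \<Longrightarrow> u \<in> box ?m" for u z
    by (auto simp: line_start_def line_end_def face_def box_def)
  have source: "edge_len h (edge_code c (vx u)) \<le> ?\<psi> c u"
    and sink: "edge_len h (edge_code (3 + c) (vx u)) \<le> 64 * real h - ?\<psi> c u"
    if "u \<in> box ?m" "c < 3" for c u
    using edge_len_source[OF that h] edge_len_sink[OF that h] by simp_all
  have "(\<Sum>z<4. \<Sum>c<3. \<Sum>u\<in>lat ?m z. edge_len h (edge_code (vx u) (vx (shift z 1 u))) - sg z c * (?\<psi> c (shift z 1 u) - ?\<psi> c u)) \<le> 0"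
    using lat by (intro sum_nonpos) auto
  moreover have "(\<Sum>z<4. \<Sum>c<3. \<Sum>u\<in>line_start ?m z. edge_len h (edge_code (if z = c then 3 + c else c) (vx u)) -
      (if z = c then 64 * real h - ?\<psi> c u else ?\<psi> c u)) \<le> 0"
    using edge_len_source[OF in_box(1) _ h] edge_len_sink[OF in_box(1) _ h] by (intro sum_nonpos) simp
  moreover have "(\<Sum>z<4. \<Sum>c<3. \<Sum>u\<in>line_end ?m z. edge_len h (edge_code (if z = c then c else 3 + c) (vx u)) -
      (if z = c then ?\<psi> c u else 64 * real h - ?\<psi> c u)) \<le> 0"
    using edge_len_source[OF in_box(2) _ h] edge_len_sink[OF in_box(2) _ h] by (intro sum_nonpos) simp
  moreover have "(\<Sum>u\<in>face ?m 0. edge_len h (edge_code 1 (vx u)) + edge_len h (edge_code 2 (vx u)) - 64 * real h) \<le> 0"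
  proof (rule sum_nonpos)
    fix u assume u: "u \<in> face ?m 0"
    then have "fst u = 0" by (auto simp: face_def)
    then show "edge_len h (edge_code 1 (vx u)) + edge_len h (edge_code 2 (vx u)) - 64 * real h \<le> 0"
      using source[of u 1] source[of u 2] in_box u base_pot_1_2[of u] by simp
  qed
  moreover have "(\<Sum>u\<in>face ?m ?m. edge_len h (edge_code 4 (vx u)) + edge_len h (edge_code 5 (vx u)) - 48 * real h) \<le> 0"
  proof (rule sum_nonpos)
    fix u assume u: "u \<in> face ?m ?m"
    then have "fst u = ?m" by (auto simp: face_def)
    then show "edge_len h (edge_code 4 (vx u)) + edge_len h (edge_code 5 (vx u)) - 48 * real h \<le> 0"
      using sink[of u 1] sink[of u 2] in_box u base_pot_1_2[of u] by simp
  qed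
  ultimately show ?thesis
    unfolding base_volume_def
      volume_split[of "edge_len h" ?m "64 * real h" "64 * real h" "48 * real h" ?\<psi>]
    by linarith
qed

lemma base_volume_le:
  assumes "0 < h"
  shows "base_volume h \<le> 200000 * real h ^ 3"
proof -
  have "real ((8 * h + 1)\<^sup>2) \<le> (9 * real h)\<^sup>2"
    using assms by (simp only: of_nat_power) (intro power_mono; simp)
  then have sq: "real ((8 * h + 1)\<^sup>2) \<le> 81 * real h ^ 2" by (simp add: power_mult_distrib)
  have "real (card (line_end (8 * h) z)) \<le> 243 * real h ^ 2" if "z < 4" for z
  proof -
    have "real (card (line_end (8 * h) z)) \<le> 3 * real ((8 * h + 1)\<^sup>2)"
      using card_line_end_le[OF that, of "8 * h"] by (metis of_nat_le_iff of_nat_mult of_nat_numeral)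
    then show ?thesis using sq by linarith
  qed
  then have "(\<Sum>z<4. \<Sum>c<3::nat. 64 * real h * real (card (line_end (8 * h) z))) \<le>
      (\<Sum>z<4::nat. \<Sum>c<3::nat. 64 * real h * (243 * real h ^ 2))"
    by (intro sum_mono mult_left_mono) auto
  moreover have "112 * real h * real ((8 * h + 1)\<^sup>2) \<le> 112 * real h * (81 * real h ^ 2)"
    using sq by (intro mult_left_mono) auto
  ultimately have "base_volume h \<le> 195696 * real h ^ 3"
    unfolding base_volume_def by (simp add: power2_eq_square power3_eq_cube)
  also have "\<dots> \<le> 200000 * real h ^ 3" by (intro mult_right_mono) auto
  finally show ?thesis .
qed

lemma target_le_path_length:
  assumes p: "p \<in> paths_between (hard_graph m) P"
  shows "target h P \<le> (\<Sum>e\<in>set (snd p). edge_len h e)"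
proof -
  obtain vs es where [simp]: "p = (vs, es)" by (cases p)
  have path: "is_path (hard_graph m) (vs, es)" and P: "{hd vs, last vs} = P"
    using p by (auto simp: paths_between_def)
  have pot: "\<bar>pot h a (last vs) - pot h a (hd vs)\<bar> \<le> (\<Sum>e\<in>set es. edge_len h e)" if "a < 5" for a
    using that by (intro potential_le_path_length[OF path] pot_lipschitz) (auto simp: hard_graph_def)
  have pair: "\<bar>pot h a x - pot h a y\<bar> \<le> (\<Sum>e\<in>set es. edge_len h e)" if "P = {x, y}" "a < 5" for a x y
    using pot[OF that(2)] that(1) P by (auto simp: doubleton_eq_iff abs_minus_commute)
  have "0 \<le> (\<Sum>e\<in>set es. edge_len h e)" using edge_len_ge_1 by (intro sum_nonneg) (meson order_trans zero_le_one)
  moreover have "P = {0, 3} \<or> P = {1, 4} \<or> P = {2, 5} \<or> P = {1, 2} \<or> P = {4, 5} \<or> target h P = 0"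
    by (auto simp: target_def)
  ultimately show ?thesis
    using pair[of 0 3 0] pair[of 1 4 1] pair[of 2 5 2] pair[of 1 2 3] pair[of 4 5 4]
    by (elim disjE) (simp_all add: target_def pot_def doubleton_eq_iff)
qed

section \<open>Volume of contractions\<close>

text \<open>If the bound fails, the remainders in \<open>volume_split\<close> sum to at most
  \<open>E\<close>. The distances from the \<open>s\<^sub>c\<close>, pulled back to the lattice, are
  then \<open>nearly_tight\<close> while taking at most \<open>N\<close> values, which is
  impossible.\<close>

lemma contracted_volume_ge:
  fixes h \<kappa> N :: nat and l :: "nat \<Rightarrow> real" and F :: "nat set set"
  defines "G \<equiv> hard_graph (8 * h)" and "T \<equiv> {..<6::nat}"
  defines "H \<equiv> contract G T F"
  assumes h: "h = 2 ^ \<kappa>" and N: "0 < N" "(1 - 1 / (8192 * real N)) ^ \<kappa> * real N < 1 / 100"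
    and F: "partition_on (verts G) F" "\<forall>P\<in>F. \<forall>t\<in>P \<inter> T. \<forall>t'\<in>P \<inter> T. t = t'"
    and few: "card (verts H) \<le> N"
    and l: "\<And>e. 0 \<le> l e"
    and dist: "\<And>P p. P \<in> terminal_pairs T \<Longrightarrow> p \<in> paths_between H P \<Longrightarrow> target h P \<le> (\<Sum>e\<in>set (snd p). l e)"
  shows "(1 + 1 / 10 ^ 18) * base_volume h \<le> (\<Sum>e\<in>edges H. cap H e * l e)"
proof (rule ccontr)
  assume neg: "\<not> ?thesis"
  let ?m = "8 * h"
  have h0: "0 < h" using h by simp
  have finG: "finite (verts G)" "finite (edges G)"
    using hard_graph_simple[of ?m] by (simp_all add: G_def cap_simple_graph_def cap_multigraph_def)
  note finH = finite_contract[OF F(1) finG, of T, folded H_def]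
  have TG: "T \<subseteq> verts G" by (auto simp: T_def G_def hard_graph_def)
  define \<pi> where "\<pi> x = part_vertex T (part_of F x)" for x
  have \<pi>T: "\<pi> t = t" if "t < 6" for t
    unfolding \<pi>_def using F TG that by (intro part_vertex_terminal) (auto simp: T_def)
  have \<pi>V: "\<pi> x \<in> verts H" if "x \<in> verts G" for x
    unfolding \<pi>_def H_def using F(1) that by (rule contract_verts)
  have tV: "t \<in> verts H" if "t < 6" for t using \<pi>V[of t] \<pi>T[OF that] TG that by (auto simp: T_def)
  \<comment> \<open>The lengths pulled back to \<open>G\<close>; edges lost in the contraction get
    length zero, so the volume is unchanged.\<close>
  define F' where "F' e = (if e \<in> edges H then l e else 0)" for e
  have cost: "(\<Sum>e\<in>edges H. cap H e * l e) = (\<Sum>x\<in>steps ?m. F' (step_edge x))"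
  proof -
    have "edges H \<subseteq> edges G" "cap H = cap G" by (auto simp: H_def contract_def)
    then have "(\<Sum>e\<in>edges H. cap H e * l e) = (\<Sum>e\<in>edges G. cap G e * F' e)"
      using finG by (intro sum.mono_neutral_cong_left) (auto simp: F'_def)
    then show ?thesis by (simp add: G_def sum_cap_hard_graph)
  qed
  \<comment> \<open>A distance potential from \<open>s\<close> in \<open>H\<close>, capped at
    \<open>64 * h\<close>, the largest value of \<open>target\<close>.\<close>
  define good where "good s \<phi> \<longleftrightarrow> \<phi> s = 0 \<and> (\<forall>x. 0 \<le> \<phi> x \<and> \<phi> x \<le> 64 * real h) \<and>
    (\<forall>e\<in>edges H. \<forall>x\<in>verts H. \<forall>y\<in>verts H. ends H e = {x, y} \<longrightarrow> \<bar>\<phi> y - \<phi> x\<bar> \<le> l e) \<and>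
    (\<forall>t b. b \<le> 64 * real h \<longrightarrow> (\<forall>p\<in>paths_between H {s, t}. b \<le> (\<Sum>e\<in>set (snd p). l e)) \<longrightarrow> b \<le> \<phi> t)"
    for s and \<phi> :: "nat \<Rightarrow> real"
  have "\<exists>\<phi>. good s \<phi>" if "s < 6" for s
    unfolding good_def by (rule exists_distance_potential[OF finH l tV[OF that]]) simp
  then obtain \<Phi> where \<Phi>: "\<And>s. s < 6 \<Longrightarrow> good s (\<Phi> s)" by metis
  have \<Phi>0: "\<Phi> s s = 0" and \<Phi>range: "0 \<le> \<Phi> s x \<and> \<Phi> s x \<le> 64 * real h" if "s < 6" for s x
    using \<Phi>[OF that] by (simp_all add: good_def)
  have \<Phi>lip: "\<bar>\<Phi> s y - \<Phi> s x\<bar> \<le> l e"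
    if "s < 6" "e \<in> edges H" "x \<in> verts H" "y \<in> verts H" "ends H e = {x, y}" for s e x y
    using \<Phi>[OF that(1)] that(2-5) unfolding good_def by blast
  have \<Phi>far: "b \<le> \<Phi> s t"
    if "s < 6" "b \<le> 64 * real h" "\<And>p. p \<in> paths_between H {s, t} \<Longrightarrow> b \<le> (\<Sum>e\<in>set (snd p). l e)" for s t b
    using \<Phi>[OF that(1)] that(2,3) unfolding good_def by blast
  have far: "target h {s, t} \<le> \<Phi> s t" if "s < 6" "t < 6" "s \<noteq> t" for s t
  proof (rule \<Phi>far[OF that(1)])
    show "target h {s, t} \<le> 64 * real h" by (simp add: target_def)
    show "target h {s, t} \<le> (\<Sum>e\<in>set (snd p). l e)" if "p \<in> paths_between H {s, t}" for p
      using that \<open>s < 6\<close> \<open>t < 6\<close> \<open>s \<noteq> t\<close> by (intro dist) (auto simp: terminal_pairs_def T_def)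
  qed
  have lipF: "\<bar>\<Phi> s (\<pi> b) - \<Phi> s (\<pi> a)\<bar> \<le> F' (edge_code a b)"
    if "s < 6" "x \<in> steps ?m" "step_ends x = (a, b)" for s x a b
  proof -
    have ab: "a \<in> verts G" "b \<in> verts G"
      using step_ends_cases[OF that(2,3)] by (auto simp: G_def hard_graph_def)
    have eG: "edge_code a b \<in> edges G"
      using that(2,3) by (force simp: G_def hard_graph_def step_edge_def image_iff)
    have ends: "ends G (edge_code a b) = {a, b}" by (simp add: G_def hard_graph_def)
    show ?thesis
    proof (cases "edge_code a b \<in> edges H")
      case True
      have "ends H (edge_code a b) = {\<pi> a, \<pi> b}" using ends by (simp add: H_def contract_def \<pi>_def)
      from \<Phi>lip[OF that(1) True \<pi>V[OF ab(1)] \<pi>V[OF ab(2)] this] True show ?thesis by (simp add: F'_def)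
    next
      case False
      then have "\<pi> a = \<pi> b"
        using contract_discarded[OF F(1) eG _ ends] by (simp add: H_def \<pi>_def)
      then show ?thesis using False by (simp add: F'_def)
    qed
  qed
  define \<psi> where "\<psi> c u = \<Phi> c (\<pi> (vx u))" for c u
  define L where "L z u = F' (edge_code (vx u) (vx (shift z 1 u)))" for z u
  have lat: "\<bar>\<Phi> s (\<pi> (vx (shift z 1 u))) - \<Phi> s (\<pi> (vx u))\<bar> \<le> L z u" if "s < 6" "z < 4" "u \<in> lat ?m z" for s z u
    unfolding L_def using that by (intro lipF[of s "Inl (z, 0, u)"]) (auto simp: steps_def lines_def)
  have start: "\<bar>\<Phi> s (\<pi> (vx u)) - \<Phi> s (if z = c then 3 + c else c)\<bar> \<le> F' (edge_code (if z = c then 3 + c else c) (vx u))"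
    if "s < 6" "z < 4" "c < 3" "u \<in> line_start ?m z" for s z c u
  proof -
    have "Inr (Inl (z, c, u)) \<in> steps ?m" using that by (auto simp: steps_def lines_def)
    from lipF[OF that(1) this step_ends.simps(2)] show ?thesis
      using \<pi>T[of c] \<pi>T[of "3 + c"] that by (cases "z = c") simp_all
  qed
  have "end": "\<bar>\<Phi> s (\<pi> (vx u)) - \<Phi> s (if z = c then c else 3 + c)\<bar> \<le> F' (edge_code (if z = c then c else 3 + c) (vx u))"
    if "s < 6" "z < 4" "c < 3" "u \<in> line_end ?m z" for s z c u
  proof -
    have "Inr (Inr (Inl (z, c, u))) \<in> steps ?m" using that by (auto simp: steps_def lines_def)
    from lipF[OF that(1) this step_ends.simps(3)] show ?thesis
      using \<pi>T[of c] \<pi>T[of "3 + c"] that by (cases "z = c") simp_all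
  qed
  have face0: "\<bar>\<Phi> s (\<pi> (vx u)) - \<Phi> s c\<bar> \<le> F' (edge_code c (vx u))"
    if "s < 6" "c \<in> {1, 2}" "u \<in> face ?m 0" for s c u
  proof -
    have "Inr (Inr (Inr (Inl (c, u)))) \<in> steps ?m" using that by (auto simp: steps_def)
    from lipF[OF that(1) this step_ends.simps(4)] show ?thesis using \<pi>T[of c] that by auto
  qed
  have face1: "\<bar>\<Phi> s (\<pi> (vx u)) - \<Phi> s (3 + c)\<bar> \<le> F' (edge_code (3 + c) (vx u))"
    if "s < 6" "c \<in> {1, 2}" "u \<in> face ?m ?m" for s c u
  proof -
    have "Inr (Inr (Inr (Inr (c, u)))) \<in> steps ?m" using that by (auto simp: steps_def)
    from lipF[OF that(1) this step_ends.simps(5)] show ?thesis using \<pi>T[of "3 + c"] that by auto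
  qed
  have sink: "64 * real h \<le> \<Phi> c (3 + c)" if "c < 3" for c
    using far[of c "3 + c"] nat_less_3[OF that] by (auto simp: target_def)
  have s12: "64 * real h \<le> \<Phi> 1 2" and t12: "48 * real h \<le> \<Phi> 4 5"
    using far[of 1 2] far[of 4 5] by (simp_all add: target_def doubleton_eq_iff)
  define A1 where "A1 = (\<Sum>z<4. \<Sum>c<3. \<Sum>u\<in>lat ?m z. F' (edge_code (vx u) (vx (shift z 1 u))) - sg z c * (\<psi> c (shift z 1 u) - \<psi> c u))"
  define A2 where "A2 = (\<Sum>z<4. \<Sum>c<3. \<Sum>u\<in>line_start ?m z. F' (edge_code (if z = c then 3 + c else c) (vx u)) - (if z = c then 64 * real h - \<psi> c u else \<psi> c u))"
  define A3 where "A3 = (\<Sum>z<4. \<Sum>c<3. \<Sum>u\<in>line_end ?m z. F' (edge_code (if z = c then c else 3 + c) (vx u)) - (if z = c then \<psi> c u else 64 * real h - \<psi> c u))"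
  define e0 where "e0 u = F' (edge_code 1 (vx u)) + F' (edge_code 2 (vx u)) - 64 * real h" for u
  define e1 where "e1 u = F' (edge_code 4 (vx u)) + F' (edge_code 5 (vx u)) - 48 * real h" for u
  have split: "(\<Sum>e\<in>edges H. cap H e * l e) =
      base_volume h + A1 + A2 + A3 + (\<Sum>u\<in>face ?m 0. e0 u) + (\<Sum>u\<in>face ?m ?m. e1 u)"
    unfolding cost volume_split[of F' ?m "64 * real h" "64 * real h" "48 * real h" \<psi>]
      A1_def A2_def A3_def e0_def e1_def base_volume_def by simp
  have A1: "0 \<le> A1" unfolding A1_def
  proof (intro sum_nonneg)
    fix z c u assume "z \<in> {..<4::nat}" "c \<in> {..<3::nat}" "u \<in> lat ?m z"
    then show "0 \<le> F' (edge_code (vx u) (vx (shift z 1 u))) - sg z c * (\<psi> c (shift z 1 u) - \<psi> c u)"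
      using lat[of c z u] by (cases "z = c") (simp_all add: \<psi>_def L_def sg_def abs_le_iff)
  qed
  have A2: "0 \<le> A2" unfolding A2_def
  proof (intro sum_nonneg)
    fix z c u assume "z \<in> {..<4::nat}" "c \<in> {..<3::nat}" "u \<in> line_start ?m z"
    then show "0 \<le> F' (edge_code (if z = c then 3 + c else c) (vx u)) - (if z = c then 64 * real h - \<psi> c u else \<psi> c u)"
      using start[of c z c u] sink[of c] \<Phi>0[of c] by (cases "z = c") (simp_all add: \<psi>_def abs_le_iff)
  qed
  have A3: "0 \<le> A3" unfolding A3_def
  proof (intro sum_nonneg)
    fix z c u assume "z \<in> {..<4::nat}" "c \<in> {..<3::nat}" "u \<in> line_end ?m z"
    then show "0 \<le> F' (edge_code (if z = c then c else 3 + c) (vx u)) - (if z = c then \<psi> c u else 64 * real h - \<psi> c u)"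
      using "end"[of c z c u] sink[of c] \<Phi>0[of c] by (cases "z = c") (simp_all add: \<psi>_def abs_le_iff)
  qed
  have e0: "0 \<le> e0 u" "\<psi> 1 u + \<psi> 2 u - 64 * real h \<le> e0 u" if "u \<in> face ?m 0" for u
    using face0[of 1 1 u] face0[of 1 2 u] face0[of 2 2 u] that s12 \<Phi>0[of 1] \<Phi>0[of 2]
    by (simp_all add: e0_def \<psi>_def abs_le_iff)
  \<comment> \<open>The number 80 is 64 + 64 - 48: the two distances from \<open>s\<^sub>c\<close>
    to \<open>t\<^sub>c\<close> minus the one from \<open>t\<^sub>1\<close> to
    \<open>t\<^sub>2\<close>.\<close>
  have e1: "0 \<le> e1 u" "80 * real h - \<psi> 1 u - \<psi> 2 u \<le> e1 u" if "u \<in> face ?m ?m" for u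
    using face1[of 4 1 u] face1[of 4 2 u] face1[of 1 1 u] face1[of 2 2 u] that t12 \<Phi>0[of 4] sink[of 1] sink[of 2]
    by (simp_all add: e1_def \<psi>_def abs_le_iff)
  have S0: "0 \<le> (\<Sum>u\<in>face ?m 0. e0 u)" and S1: "0 \<le> (\<Sum>u\<in>face ?m ?m. e1 u)"
    using e0 e1 by (auto intro: sum_nonneg)
  \<comment> \<open>The base volume is at most \<open>10 ^ 12 * h ^ 3\<close>, so a relative excess
    below \<open>1 / 10 ^ 18\<close> is an absolute excess of at most \<open>E\<close>.\<close>
  define E where "E = real h ^ 3 / 10 ^ 6"
  have "base_volume h \<le> 1000000000000 * real h ^ 3"
    using base_volume_le[OF h0] zero_le_power[of "real h" 3] by linarith
  then have "base_volume h / 10 ^ 18 \<le> E" by (simp add: E_def)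
  moreover have "(\<Sum>e\<in>edges H. cap H e * l e) < base_volume h + base_volume h / 10 ^ 18"
    using neg by (simp add: algebra_simps)
  ultimately have excess: "A1 + A2 + A3 + (\<Sum>u\<in>face ?m 0. e0 u) + (\<Sum>u\<in>face ?m ?m. e1 u) \<le> E"
    unfolding split by linarith
  interpret nearly_tight h \<psi> L E
  proof
    show "\<bar>\<psi> c (shift z 1 u) - \<psi> c u\<bar> \<le> L z u" if "z < 4" "c < 3" "u \<in> lat ?m z" for z c u
      unfolding \<psi>_def using that by (intro lat) auto
    have "(\<Sum>z<4. \<Sum>u\<in>lat ?m z. \<Sum>c<3. L z u - sg z c * (\<psi> c (shift z 1 u) - \<psi> c u)) = A1"
      unfolding A1_def L_def by (intro sum.cong refl sum.swap)
    then show "(\<Sum>z<4. \<Sum>u\<in>lat ?m z. \<Sum>c<3. L z u - sg z c * (\<psi> c (shift z 1 u) - \<psi> c u)) \<le> E"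
      using excess A2 A3 S0 S1 by linarith
  qed
  let ?Q = "{h..6 * h} \<times> {h..6 * h}"
  have Q0: "(0, w) \<in> face ?m 0" "(?m, w) \<in> face ?m ?m" "shift 0 ?m (0, w) = (?m, w)" "(?m, w) \<in> B"
    if "w \<in> ?Q" for w
    using that by (auto simp: face_def shift_def box_def)
  \<comment> \<open>Up to slack, \<open>\<psi> 1 + \<psi> 2\<close> is at most \<open>64 * h\<close>
    on the face \<open>0\<close> and at least \<open>80 * h\<close> on the opposite one. Both
    functions change almost equally along direction \<open>0\<close>, so \<open>\<psi> 1\<close>
    rises by nearly \<open>8 * h\<close> or more.\<close>
  have "(\<Sum>w\<in>?Q. 2 * (8 * real h)) \<le> (\<Sum>w\<in>?Q. 2 * (\<psi> 1 (?m, w) - \<psi> 1 (0, w)) + e0 (0, w) + e1 (?m, w) + V 0 ?m (0, w))"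
  proof (rule sum_mono)
    fix w assume w: "w \<in> ?Q"
    have "\<bar>(\<psi> 1 (?m, w) - \<psi> 1 (0, w)) - (\<psi> 2 (?m, w) - \<psi> 2 (0, w))\<bar> \<le> V 0 ?m (0, w)"
      using chain[of 0 1 2 ?m "(0, w)"] Q0[OF w] by (simp add: sg_def)
    then show "2 * (8 * real h) \<le> 2 * (\<psi> 1 (?m, w) - \<psi> 1 (0, w)) + e0 (0, w) + e1 (?m, w) + V 0 ?m (0, w)"
      using e0(2)[OF Q0(1)[OF w]] e1(2)[OF Q0(2)[OF w]] by (simp add: abs_le_iff)
  qed
  also have "\<dots> = 2 * (\<Sum>w\<in>?Q. \<psi> 1 (?m, w) - \<psi> 1 (0, w)) + (\<Sum>w\<in>?Q. e0 (0, w)) + (\<Sum>w\<in>?Q. e1 (?m, w)) + (\<Sum>w\<in>?Q. V 0 ?m (0, w))"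
    by (simp add: sum.distrib sum_distrib_left)
  also have "(\<Sum>w\<in>?Q. e0 (0, w)) \<le> (\<Sum>u\<in>face ?m 0. e0 u)"
  proof -
    have "(\<Sum>w\<in>?Q. e0 (0, w)) = (\<Sum>u\<in>Pair 0 ` ?Q. e0 u)" by (subst sum.reindex) (auto simp: inj_on_def)
    also have "\<dots> \<le> (\<Sum>u\<in>face ?m 0. e0 u)" using Q0(1) e0(1) by (intro sum_mono2) auto
    finally show ?thesis .
  qed
  also have "(\<Sum>w\<in>?Q. e1 (?m, w)) \<le> (\<Sum>u\<in>face ?m ?m. e1 u)"
  proof -
    have "(\<Sum>w\<in>?Q. e1 (?m, w)) = (\<Sum>u\<in>Pair ?m ` ?Q. e1 u)" by (subst sum.reindex) (auto simp: inj_on_def)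
    also have "\<dots> \<le> (\<Sum>u\<in>face ?m ?m. e1 u)" using Q0(2) e1(1) by (intro sum_mono2) auto
    finally show ?thesis .
  qed
  also have "(\<Sum>w\<in>?Q. V 0 ?m (0, w)) \<le> E"
    by (rule sum_V_le) (auto simp: inj_on_def shift_def box_def)
  finally have "(\<Sum>w\<in>?Q. 2 * (8 * real h)) \<le> 2 * (\<Sum>w\<in>?Q. \<psi> 1 (?m, w) - \<psi> 1 (0, w)) + 2 * E"
    using excess A1 A2 A3 by linarith
  moreover have "400 * real h ^ 3 \<le> (\<Sum>w\<in>?Q. 2 * (8 * real h))"
  proof -
    have "real (card ?Q) = (5 * real h + 1) ^ 2" by (simp add: card_cartesian_product power2_eq_square algebra_simps)
    moreover have "(5 * real h) ^ 2 \<le> (5 * real h + 1) ^ 2" by (intro power_mono) auto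
    ultimately have "25 * real h ^ 2 * (16 * real h) \<le> real (card ?Q) * (16 * real h)"
      by (intro mult_right_mono) (auto simp: power_mult_distrib)
    then show ?thesis by (simp add: power2_eq_square power3_eq_cube)
  qed
  ultimately have pin: "200 * real h ^ 3 - 2 * E \<le> (\<Sum>w\<in>?Q. \<psi> 1 (?m, w) - \<psi> 1 (0, w))"
    using E_nonneg by linarith
  \<comment> \<open>\<open>\<psi> 1\<close> factors through the vertices of
    \<open>H\<close>.\<close>
  have "\<psi> 1 ` B \<subseteq> \<Phi> 1 ` verts H"
    unfolding \<psi>_def using \<pi>V by (auto simp: G_def hard_graph_def)
  then have "card (\<psi> 1 ` B) \<le> card (\<Phi> 1 ` verts H)" using finH by (intro card_mono) auto
  also have "\<dots> \<le> N" using card_image_le[OF finH(1), of "\<Phi> 1"] few by simp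
  finally have "card (\<psi> 1 ` B) \<le> N" .
  then show False
    using few_values_impossible[OF h N pin] \<Phi>range[of 1] by (simp add: E_def \<psi>_def)
qed

section \<open>Choice of parameters and conclusion\<close>

theorem theorem1p2:
  fixes N :: nat
  assumes "N > 0"
  shows "\<exists>(G :: (nat, nat) cap_graph) T.
    cap_simple_graph G \<and> T \<subseteq> verts G \<and> card T = 6 \<and>
    (\<forall>H. contraction_based G T H \<and> card (verts H) \<le> N \<longrightarrow>
       (\<forall>q. flow_sparsifier G T q H \<longrightarrow> q \<ge> 1 + 1 / 10 ^ 18) \<and>
       (\<exists>D. demand_on T D \<and> 0 < congestion H T D \<and> congestion H T D < \<infinity> \<and>
            congestion G T D \<ge> ereal (1 + 1 / 10 ^ 18) * congestion H T D))"
proof -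
  let ?x = "1 + 1 / 10 ^ 18 :: real"
  \<comment> \<open>There must be enough dyadic scales to outweigh \<open>N\<close>; the side of the
    lattice is then \<open>8 * 2 ^ \<kappa>\<close>.\<close>
  have "\<exists>\<kappa>. (1 - 1 / (8192 * real N)) ^ \<kappa> < 1 / (100 * real N)"
    using assms by (intro real_arch_pow_inv) (auto simp: field_simps)
  then obtain \<kappa> where "(1 - 1 / (8192 * real N)) ^ \<kappa> < 1 / (100 * real N)" ..
  then have \<kappa>: "(1 - 1 / (8192 * real N)) ^ \<kappa> * real N < 1 / 100"
    using assms by (simp add: field_simps)
  define h :: nat where "h = 2 ^ \<kappa>"
  define G where "G = hard_graph (8 * h)"
  define T where "T = {..<6::nat}"
  have h: "0 < h" by (simp add: h_def)
  have simple: "cap_simple_graph G" unfolding G_def by (rule hard_graph_simple)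
  then have G: "finite (verts G)" "finite (edges G)" "\<And>e. e \<in> edges G \<Longrightarrow> 0 < cap G e"
    by (auto simp: cap_simple_graph_def cap_multigraph_def)
  have T: "T \<subseteq> verts G" "card T = 6" "finite T" by (auto simp: T_def G_def hard_graph_def)
  have gap: "\<exists>D. demand_on T D \<and> 0 < congestion H T D \<and> congestion H T D < \<infinity> \<and>
      congestion G T D \<ge> ereal ?x * congestion H T D"
    if H: "contraction_based G T H" "card (verts H) \<le> N" for H
  proof -
    obtain F where F: "partition_on (verts G) F" "\<forall>P\<in>F. \<forall>t\<in>P \<inter> T. \<forall>t'\<in>P \<inter> T. t = t'"
      and HF: "H = contract G T F"
      using H(1) by (auto simp: contraction_based_def)
    define W where "W = (\<Sum>e\<in>edges G. cap G e * edge_len h e)"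
    have WW: "W \<le> base_volume h"
      unfolding W_def G_def sum_cap_hard_graph by (rule volume_le_base_volume[OF h])
    have len0: "0 \<le> edge_len h e" "0 < edge_len h e" for e using edge_len_ge_1[of h e] by auto
    have "Inl (0, 0, 0, 0, 0) \<in> steps (8 * h)"
      using h by (auto simp: steps_def lines_def lat_def box_def shift_def)
    then have "edges G \<noteq> {}" by (auto simp: G_def hard_graph_def)
    then have W0: "0 < W" unfolding W_def using G len0 by (intro sum_pos) auto
    show ?thesis
    proof (rule demand_gap_if_dual_gap[OF G(1,2) T(3) G(3) len0(1) _ W_def W0])
      show "target h P \<le> (\<Sum>e\<in>set (snd p). edge_len h e)" if "p \<in> paths_between G P" for P p
        using that unfolding G_def by (rule target_le_path_length)
      show "finite (verts H)" "finite (edges H)" unfolding HF by (rule finite_contract[OF F(1) G(1,2)])+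
      show "0 < cap H e" if "e \<in> edges H" for e using that G(3) by (auto simp: HF contract_def)
      show "0 \<le> target h P" for P by (simp add: target_def)
      show "0 < ?x" by (simp add: add_pos_pos)
      fix l :: "nat \<Rightarrow> real"
      assume l: "\<And>e. 0 \<le> l e" "\<And>P p. P \<in> terminal_pairs T \<Longrightarrow> p \<in> paths_between H P \<Longrightarrow> target h P \<le> (\<Sum>e\<in>set (snd p). l e)"
      have "?x * base_volume h \<le> (\<Sum>e\<in>edges H. cap H e * l e)"
        using contracted_volume_ge[OF h_def assms \<kappa>, of F l] F H(2) l
        unfolding HF G_def[symmetric] T_def[symmetric] by blast
      then show "?x * W \<le> (\<Sum>e\<in>edges H. cap H e * l e)"
        using mult_left_mono[OF WW, of ?x] by simp
    qed
  qed
  \<comment> \<open>The demand from \<open>gap\<close> has positive finite congestion in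
    \<open>H\<close>, which can be cancelled.\<close>
  moreover have "?x \<le> q" if H: "contraction_based G T H" "card (verts H) \<le> N" and q: "flow_sparsifier G T q H" for H q
  proof -
    obtain D where D: "demand_on T D" "0 < congestion H T D" "congestion H T D < \<infinity>"
      "congestion G T D \<ge> ereal ?x * congestion H T D"
      using gap[OF H] by blast
    then obtain r where r: "congestion H T D = ereal r" "0 < r" by (cases "congestion H T D") auto
    have "ereal ?x * congestion H T D \<le> ereal q * congestion H T D"
      using D q by (meson flow_sparsifier_def order_trans)
    then show ?thesis using r by simp
  qed
  ultimately show ?thesis using simple T by blast
qed

end
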